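(* Let $k$ be a field of characteristic zero and let $A$ be an integral $k$-algebra of finite type. Let $\mathcal{F}=\{d_i\}_{i\in I}$ be a family of $k$-derivations on $A$. Then there exists an $A$-linear combination $d=\sum a_i d_i$ (with $a_i\in A$) of elements of $\mathcal{F}$ such that $\ker d=\ker\mathcal{F}$.
   Context: "Integral" means that $A$ is an integral domain. A $k$-derivation on $A$ is a $k$-linear map $d:A\to A$ satisfying the Leibniz rule; $\ker d=\{a\in A: d(a)=0\}$. For a family $\mathcal{F}$ of $k$-derivations on $A$, $\ker\mathcal{F}=\bigcap_{d\in\mathcal{F}}\ker d$. Linear combinations are finite sums (the index set $I$ may be infinite). *)

theory Defs
  imports Complex_Main
begin

text \<open>Since multiplication is commutative, compatibility on the left factor suffices.\<close>

locale algebra_over = vector_space scale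
  for scale :: "'k::field \<Rightarrow> 'a::comm_ring_1 \<Rightarrow> 'a" +
  assumes scale_mult_left: "scale c (x * y) = scale c x * y"
begin

definition subalgebra :: "'a set \<Rightarrow> bool" where
  "subalgebra B \<longleftrightarrow> subspace B \<and> 1 \<in> B \<and> (\<forall>x\<in>B. \<forall>y\<in>B. x * y \<in> B)"

definition derivation :: "('a \<Rightarrow> 'a) \<Rightarrow> bool" where
  "derivation d \<longleftrightarrow>
     Vector_Spaces.linear scale scale d \<and> (\<forall>x y. d (x * y) = x * d y + d x * y)"

end

locale finite_type_algebra = algebra_over scale
  for scale :: "'k::field \<Rightarrow> 'a::comm_ring_1 \<Rightarrow> 'a" +
  assumes finitely_generated: "\<exists>S. finite S \<and> subalgebra hull S = UNIV"

definition ker :: "('a \<Rightarrow> 'a::zero) \<Rightarrow> 'a set" where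
  "ker d = {x. d x = 0}"

text \<open>For the empty family this is the whole ring.\<close>

definition family_ker :: "'i set \<Rightarrow> ('i \<Rightarrow> 'a \<Rightarrow> 'a::zero) \<Rightarrow> 'a set" where
  "family_ker I d = (\<Inter>i\<in>I. ker (d i))"

end

theory Submission
  imports Defs "HOL-Computational_Algebra.Polynomial" "HOL-Library.Function_Algebras"
begin

text \<open>
  By linear algebra and induction it suffices to treat two derivations $d_0, d_1$. If some minor
  $\Delta = d_0 x \, d_1 u - d_0 u \, d_1 x$ is nonzero, combinations $D_0, D_1$ of them satisfy
  $D_0 x = D_1 u = \Delta$ and $D_0 u = D_1 x = 0$; the witness is
  $(x-c)^s D_0 + (u-c')^s D_1$ for suitable constants $c, c'$ and large $s$. If this kills $g$, then
  $a = D_0 g$ and $b = D_1 g$ vanish to every order along $x = c$, $u = c'$: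
  the relation $(x-c)^s a + (u-c')^s b = 0$ forces the leading forms of $a, b$ to be
  $-u^s h, x^s h$ (in shifted coordinates); all iterated brackets of $D_0, D_1$, which span
  a space of finite rank, then map $g$ to elements of positive order as well, and Euler's identity
  raises this order to the order $t$ of $a$ and $b$. In particular $D_0 b - D_1 a$ has order at least $t$, so
  $\partial_x (x^s h) + \partial_u (u^s h) = 0$, which is impossible for a nonzero form $h$.
  The constants $c, c'$ are chosen so that in the localization at the relevant denominator $\tau$
  the powers of the ideal $(x-c, u-c')$ intersect in $0$, by an elimination over the generators
  of the algebra.
\<close>

section \<open>Elimination in finitely generated extensions\<close>

definition is_subring :: "'a::comm_ring_1 set \<Rightarrow> bool" where
  "is_subring R \<longleftrightarrow> 0 \<in> R \<and> 1 \<in> R \<and>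
     (\<forall>a\<in>R. \<forall>b\<in>R. a + b \<in> R \<and> a - b \<in> R \<and> a * b \<in> R)"

definition is_ideal :: "'a::comm_ring_1 set \<Rightarrow> 'a set \<Rightarrow> bool" where
  "is_ideal R I \<longleftrightarrow> I \<subseteq> R \<and> 0 \<in> I \<and>
     (\<forall>a\<in>I. \<forall>b\<in>I. a + b \<in> I \<and> a - b \<in> I) \<and> (\<forall>r\<in>R. \<forall>a\<in>I. r * a \<in> I)"

definition coeffs_in :: "'a::comm_ring_1 set \<Rightarrow> 'a poly \<Rightarrow> bool" where
  "coeffs_in I p \<longleftrightarrow> (\<forall>i. coeff p i \<in> I)"

definition adjoin :: "'a::comm_ring_1 set \<Rightarrow> 'a \<Rightarrow> 'a set" where
  "adjoin I a = {poly p a | p. coeffs_in I p}"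

lemma is_ideal_self: "is_subring R \<Longrightarrow> is_ideal R R"
  by (auto simp: is_subring_def is_ideal_def)

lemma is_subring_power: "is_subring R \<Longrightarrow> a \<in> R \<Longrightarrow> a ^ n \<in> R"
  by (induction n) (auto simp: is_subring_def)

lemma is_ideal_sum:
  assumes "is_ideal R I" "\<And>i. i \<in> A \<Longrightarrow> f i \<in> I"
  shows "sum f A \<in> I"
  using assms(2) by (induction A rule: infinite_finite_induct) (use assms(1) in \<open>auto simp: is_ideal_def\<close>)

lemma coeffs_in_add: "is_ideal R I \<Longrightarrow> coeffs_in I p \<Longrightarrow> coeffs_in I q \<Longrightarrow> coeffs_in I (p + q)"
  by (auto simp: coeffs_in_def is_ideal_def)

lemma coeffs_in_diff: "is_ideal R I \<Longrightarrow> coeffs_in I p \<Longrightarrow> coeffs_in I q \<Longrightarrow> coeffs_in I (p - q)"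
  by (auto simp: coeffs_in_def is_ideal_def)

lemma coeffs_in_mult:
  assumes "is_ideal R I" "coeffs_in R p" "coeffs_in I q"
  shows "coeffs_in I (p * q)"
  unfolding coeffs_in_def coeff_mult
  by (intro allI is_ideal_sum[OF assms(1)]) (use assms in \<open>auto simp: is_ideal_def coeffs_in_def\<close>)

lemma coeffs_in_smult: "is_ideal R I \<Longrightarrow> c \<in> R \<Longrightarrow> coeffs_in I p \<Longrightarrow> coeffs_in I (smult c p)"
  by (auto simp: coeffs_in_def is_ideal_def)

lemma coeffs_in_monom: "0 \<in> I \<Longrightarrow> c \<in> I \<Longrightarrow> coeffs_in I (monom c n)"
  by (auto simp: coeffs_in_def coeff_monom)

lemma coeffs_in_mono: "I \<subseteq> I' \<Longrightarrow> coeffs_in I p \<Longrightarrow> coeffs_in I' p"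
  by (auto simp: coeffs_in_def)

lemma coeffs_in_const: "0 \<in> I \<Longrightarrow> c \<in> I \<Longrightarrow> coeffs_in I [:c:]"
  by (auto simp: coeffs_in_def coeff_pCons split: nat.splits)

lemma adjoinI: "coeffs_in I p \<Longrightarrow> poly p a \<in> adjoin I a"
  by (auto simp: adjoin_def)

lemma adjoin_base: "0 \<in> I \<Longrightarrow> c \<in> I \<Longrightarrow> c \<in> adjoin I a"
  using adjoinI[OF coeffs_in_const, of I c a] by simp

lemma adjoin_generator: "is_subring R \<Longrightarrow> a \<in> adjoin R a"
  using adjoinI[of R "monom 1 1" a] by (auto simp: coeffs_in_monom is_subring_def poly_monom)

lemma is_ideal_adjoin:
  assumes I: "is_ideal R I"
  shows "is_ideal (adjoin R a) (adjoin I a)"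
proof -
  have "poly p a + poly q a \<in> adjoin I a" "poly p a - poly q a \<in> adjoin I a"
    if "coeffs_in I p" "coeffs_in I q" for p q
    using adjoinI[OF coeffs_in_add[OF I that], of a] adjoinI[OF coeffs_in_diff[OF I that], of a] by auto
  moreover have "poly p a * poly q a \<in> adjoin I a" if "coeffs_in R p" "coeffs_in I q" for p q
    using adjoinI[OF coeffs_in_mult[OF I that], of a] by auto
  moreover have "0 \<in> adjoin I a"
    using adjoinI[of I 0 a] I by (auto simp: coeffs_in_def is_ideal_def)
  moreover have "adjoin I a \<subseteq> adjoin R a"
    using I by (auto simp: adjoin_def is_ideal_def intro: coeffs_in_mono)
  ultimately show ?thesis
    by (auto simp: is_ideal_def adjoin_def)
qed

lemma is_subring_adjoin:
  assumes R: "is_subring R"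
  shows "is_subring (adjoin R a)"
proof -
  have "1 \<in> adjoin R a" "is_ideal (adjoin R a) (adjoin R a)"
    using R is_ideal_adjoin[OF is_ideal_self[OF R]] by (auto simp: is_subring_def intro: adjoin_base)
  then show ?thesis
    by (auto simp: is_subring_def is_ideal_def)
qed

lemma pseudo_division_coeffs_in:
  fixes f p :: "'a::idom poly"
  assumes R: "is_subring R" and I: "is_ideal R I" and f: "coeffs_in R f" "f \<noteq> 0" and p: "coeffs_in I p"
  shows "\<exists>e q r. coeffs_in I q \<and> coeffs_in I r \<and> smult (lead_coeff f ^ e) p = q * f + r \<and>
           (r = 0 \<or> degree r < degree f)"
  using p
proof (induction "degree p" arbitrary: p rule: less_induct)
  case less
  have I0: "0 \<in> I" using I by (simp add: is_ideal_def)
  show ?case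
  proof (cases "p = 0 \<or> degree p < degree f")
    case True
    then show ?thesis
      using less.prems I0 by (intro exI[of _ 0] exI[of _ p]) (auto simp: coeffs_in_def)
  next
    case False
    define g where "g = monom (lead_coeff p) (degree p - degree f)"
    define p' where "p' = smult (lead_coeff f) p - g * f"
    have lf: "lead_coeff f \<in> R" and g: "coeffs_in I g"
      using f less.prems I0 by (auto simp: coeffs_in_def g_def coeff_monom)
    have gf: "coeffs_in I (g * f)"
      using coeffs_in_mult[OF I f(1) g] by (simp add: mult.commute)
    have p': "coeffs_in I p'"
      unfolding p'_def by (intro coeffs_in_diff[OF I] coeffs_in_smult[OF I] lf less.prems gf)
    have dg: "degree (g * f) = degree p"
      using False f by (simp add: g_def degree_mult_eq monom_eq_0_iff degree_monom_eq)
    have "coeff (g * f) (degree p) = lead_coeff p * lead_coeff f"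
      using dg lead_coeff_mult[of g f] False by (simp add: g_def degree_monom_eq)
    then have c0: "coeff p' (degree p) = 0"
      by (simp add: p'_def)
    have "degree p' \<le> degree p"
      unfolding p'_def by (intro degree_diff_le) (use dg in auto)
    then have lt: "p' = 0 \<or> degree p' < degree p"
      using c0 by (metis le_neq_implies_less leading_coeff_0_iff)
    have "\<exists>e q r. coeffs_in I q \<and> coeffs_in I r \<and> smult (lead_coeff f ^ e) p' = q * f + r \<and>
           (r = 0 \<or> degree r < degree f)"
    proof (cases "p' = 0")
      case True
      then show ?thesis
        using I0 by (intro exI[of _ 0]) (auto simp: coeffs_in_def)
    next
      case False
      then show ?thesis
        using lt less.hyps p' by blast
    qed
    then obtain e q r where q: "coeffs_in I q" "coeffs_in I r" "r = 0 \<or> degree r < degree f"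
      and eq: "smult (lead_coeff f ^ e) p' = q * f + r" by blast
    have "smult (lead_coeff f ^ Suc e) p = smult (lead_coeff f ^ e) (p' + g * f)"
      by (simp add: p'_def power_Suc2 del: power_Suc)
    also have "\<dots> = (q + smult (lead_coeff f ^ e) g) * f + r"
      by (simp add: smult_add_right eq algebra_simps)
    finally have "smult (lead_coeff f ^ Suc e) p = (q + smult (lead_coeff f ^ e) g) * f + r" .
    moreover have "coeffs_in I (q + smult (lead_coeff f ^ e) g)"
      by (intro coeffs_in_add[OF I] coeffs_in_smult[OF I] is_subring_power[OF R] lf q g)
    ultimately show ?thesis
      using q by blast
  qed
qed

definition transc :: "'a::comm_ring_1 set \<Rightarrow> 'a \<Rightarrow> bool" where
  "transc R a \<longleftrightarrow> (\<forall>p. coeffs_in R p \<longrightarrow> poly p a = 0 \<longrightarrow> p = 0)"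

lemma transc_poly_inj:
  assumes "is_subring R" "transc R a" "coeffs_in R p" "coeffs_in R q" "poly p a = poly q a"
  shows "p = q"
proof -
  have "coeffs_in R (p - q)"
    using assms by (auto intro: coeffs_in_diff is_ideal_self)
  then have "p - q = 0"
    using assms(2,5) by (auto simp: transc_def)
  then show ?thesis by simp
qed

lemma not_transc_minimal:
  assumes "\<not> transc R a"
  obtains m where "coeffs_in R m" "m \<noteq> 0" "poly m a = 0"
    "\<And>p. coeffs_in R p \<Longrightarrow> poly p a = 0 \<Longrightarrow> degree p < degree m \<Longrightarrow> p = 0"
proof -
  let ?P = "\<lambda>p. coeffs_in R p \<and> poly p a = 0 \<and> p \<noteq> 0"
  obtain p where "?P p" using assms by (auto simp: transc_def)
  then obtain m where "?P m" "\<And>q. ?P q \<Longrightarrow> degree m \<le> degree q"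
    using exists_least_iff[of "\<lambda>n. \<exists>p. ?P p \<and> degree p = n"]
    by (metis not_le_imp_less)
  then show ?thesis
    using that by (metis not_le)
qed

lemma algebraic_norm:
  fixes a :: "'a::idom"
  assumes R: "is_subring R" and na: "\<not> transc R a" and \<tau>: "\<tau> \<in> adjoin R a" "\<tau> \<noteq> 0"
  shows "\<exists>s\<in>adjoin R a. s * \<tau> \<in> R \<and> s * \<tau> \<noteq> 0"
proof -
  obtain m where m: "coeffs_in R m" "m \<noteq> 0" "poly m a = 0"
    and mmin: "\<And>p. coeffs_in R p \<Longrightarrow> poly p a = 0 \<Longrightarrow> degree p < degree m \<Longrightarrow> p = 0"
    using not_transc_minimal[OF na] by metis
  note IR = is_ideal_self[OF R]
  note sub = is_subring_adjoin[OF R, of a]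
  let ?T = "(\<lambda>s. s * \<tau>) ` adjoin R a"
  have T: "is_ideal (adjoin R a) ?T"
  proof -
    have "\<tau> * s \<in> adjoin R a" if "s \<in> adjoin R a" for s
      using that \<tau> sub by (auto simp: is_subring_def)
    moreover have "s * \<tau> + s' * \<tau> \<in> ?T" "s * \<tau> - s' * \<tau> \<in> ?T" "s * (s' * \<tau>) \<in> ?T"
      if "s \<in> adjoin R a" "s' \<in> adjoin R a" for s s'
      using that sub
        image_eqI[of _ "\<lambda>s. s * \<tau>" "s + s'"] image_eqI[of _ "\<lambda>s. s * \<tau>" "s - s'"]
        image_eqI[of _ "\<lambda>s. s * \<tau>" "s * s'"]
      by (auto simp: is_subring_def algebra_simps)
    moreover have "0 \<in> ?T"
      using sub by (auto simp: is_subring_def image_iff)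
    ultimately show ?thesis
      by (auto simp: is_ideal_def mult.commute)
  qed
  let ?P = "\<lambda>p. coeffs_in R p \<and> poly p a \<noteq> 0 \<and> poly p a \<in> ?T"
  have "\<exists>p. ?P p"
  proof -
    obtain p where "\<tau> = poly p a" "coeffs_in R p" using \<tau> by (auto simp: adjoin_def)
    moreover have "\<tau> \<in> ?T"
      using sub image_eqI[of \<tau> "\<lambda>s. s * \<tau>" 1] by (auto simp: is_subring_def)
    ultimately show ?thesis using \<tau> by blast
  qed
  then obtain f where f: "?P f" and fmin: "\<And>q. ?P q \<Longrightarrow> degree f \<le> degree q"
    using exists_least_iff[of "\<lambda>n. \<exists>p. ?P p \<and> degree p = n"]
    by (metis (no_types, lifting) not_le_imp_less)
  have f0: "f \<noteq> 0" using f by auto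
  have lead: "lead_coeff p \<in> R" if "coeffs_in R p" for p using that by (auto simp: coeffs_in_def)
  have "degree f = 0"
  proof (rule ccontr)
    assume df: "degree f \<noteq> 0"
    show False
    proof (cases "degree f \<le> degree m")
      case True
      obtain e q r where q: "coeffs_in R q" "coeffs_in R r" "r = 0 \<or> degree r < degree f"
        and eq: "smult (lead_coeff f ^ e) m = q * f + r"
        using pseudo_division_coeffs_in[OF R IR _ f0 m(1)] f by blast
      have ev: "poly r a = - poly q a * poly f a"
        using arg_cong[OF eq, of "\<lambda>p. poly p a"] m by (simp add: add_eq_0_iff)
      have "poly r a = 0 - poly q a * poly f a" using ev by simp
      then have "poly r a \<in> ?T"
        using T f q by (metis adjoinI is_ideal_def)
      then have "poly r a = 0"
        using fmin[of r] q f by (metis not_le poly_0)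
      then have r0: "r = 0"
        using mmin q True by (metis less_le_trans)
      have "poly q a = 0"
        using ev \<open>poly r a = 0\<close> f by auto
      have qf: "q * f \<noteq> 0"
        using eq r0 m f0 by auto
      have "degree m = degree q + degree f"
        using arg_cong[OF eq, of degree] r0 f0 qf by (simp add: degree_mult_eq)
      then have "degree q < degree m" using df by simp
      then have "q = 0" using mmin q \<open>poly q a = 0\<close> by blast
      then show False using qf by simp
    next
      case False
      obtain e q r where q: "coeffs_in R q" "coeffs_in R r" "r = 0 \<or> degree r < degree m"
        and eq: "smult (lead_coeff m ^ e) f = q * m + r"
        using pseudo_division_coeffs_in[OF R IR m(1,2)] f by blast
      have ev: "poly r a = lead_coeff m ^ e * poly f a"
        using arg_cong[OF eq, of "\<lambda>p. poly p a"] m by simp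
      then have nz: "poly r a \<noteq> 0" using f m by simp
      have "lead_coeff m ^ e \<in> adjoin R a"
        by (intro adjoin_base is_subring_power[OF R] lead m) (use R in \<open>auto simp: is_subring_def\<close>)
      then have "poly r a \<in> ?T" using T f ev by (metis is_ideal_def)
      then show False using fmin[of r] q nz False by force
    qed
  qed
  then obtain c where "f = [:c:]" by (metis degree_eq_zeroE)
  then have "poly f a \<in> R" using f by (auto simp: coeffs_in_def dest: spec[of _ 0])
  then show ?thesis using f by auto
qed

lemma adjoin_mult_generic:
  assumes R: "is_subring R" and \<tau>: "\<tau> \<in> adjoin R a" "(\<tau>::'a::idom) \<noteq> 0"
  shows "\<exists>l\<in>R. l \<noteq> 0 \<and> (\<forall>\<sigma>\<in>adjoin R a. \<sigma> \<noteq> 0 \<longrightarrow> (\<exists>\<rho>\<in>R. \<rho> \<noteq> 0 \<and>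
           (\<forall>I. is_ideal R I \<longrightarrow> (\<exists>e. \<tau> ^ e * \<sigma> \<in> adjoin I a) \<longrightarrow> (\<exists>e. l ^ e * \<rho> \<in> I))))"
proof (cases "transc R a")
  case True
  obtain f where f: "coeffs_in R f" "\<tau> = poly f a" using \<tau> by (auto simp: adjoin_def)
  show ?thesis
  proof (rule bexI[of _ "lead_coeff f"], intro conjI ballI impI)
    show "lead_coeff f \<noteq> 0" using f \<tau> by auto
    show "lead_coeff f \<in> R" using f by (auto simp: coeffs_in_def)
    fix \<sigma> assume \<sigma>: "\<sigma> \<in> adjoin R a" "\<sigma> \<noteq> 0"
    then obtain g where g: "coeffs_in R g" "\<sigma> = poly g a" by (auto simp: adjoin_def)
    show "\<exists>\<rho>\<in>R. \<rho> \<noteq> 0 \<and> (\<forall>I. is_ideal R I \<longrightarrow> (\<exists>e. \<tau> ^ e * \<sigma> \<in> adjoin I a) \<longrightarrow> (\<exists>e. lead_coeff f ^ e * \<rho> \<in> I))"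
    proof (intro bexI[of _ "lead_coeff g"] conjI allI impI)
      show "lead_coeff g \<noteq> 0" using g \<sigma> by auto
      show "lead_coeff g \<in> R" using g by (auto simp: coeffs_in_def)
      fix I assume I: "is_ideal R I" and "\<exists>e. \<tau> ^ e * \<sigma> \<in> adjoin I a"
      then obtain e p where p: "coeffs_in I p" "\<tau> ^ e * \<sigma> = poly p a" by (auto simp: adjoin_def)
      have ov: "coeffs_in R (f ^ e * g)"
      proof (induction e)
        case 0 then show ?case using g by simp
      next
        case (Suc e)
        then show ?case using coeffs_in_mult[OF is_ideal_self[OF R] f(1) Suc] by (simp add: mult.assoc)
      qed
      have "poly (f ^ e * g) a = poly p a" using p f g by simp
      then have "f ^ e * g = p"
        using transc_poly_inj[OF R True ov] p I by (auto simp: is_ideal_def coeffs_in_def)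
      then have "lead_coeff f ^ e * lead_coeff g = lead_coeff p"
        by (metis lead_coeff_mult lead_coeff_power)
      then show "\<exists>e. lead_coeff f ^ e * lead_coeff g \<in> I" using p(1) by (metis coeffs_in_def)

    qed
  qed
next
  case False
  obtain m where m: "coeffs_in R m" "m \<noteq> 0" "poly m a = 0"
    and mmin: "\<And>p. coeffs_in R p \<Longrightarrow> poly p a = 0 \<Longrightarrow> degree p < degree m \<Longrightarrow> p = 0"
    using not_transc_minimal[OF False] by metis
  have dm: "degree m > 0" using m by (auto elim!: degree_eq_zeroE intro!: gr0I)
  obtain s where s: "s \<in> adjoin R a" "s * \<tau> \<in> R" "s * \<tau> \<noteq> 0"
    using algebraic_norm[OF R False \<tau>] by blast
  define lm where "lm = lead_coeff m"
  have lm: "lm \<in> R" "lm \<noteq> 0" using m by (auto simp: lm_def coeffs_in_def)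
  have mulR: "x * y \<in> R" if "x \<in> R" "y \<in> R" for x y using that R by (auto simp: is_subring_def)
  show ?thesis
  proof (rule bexI[of _ "lm * (s * \<tau>)"], intro conjI ballI impI)
    show "lm * (s * \<tau>) \<noteq> 0" "lm * (s * \<tau>) \<in> R" using lm s mulR by auto
    fix \<sigma> assume \<sigma>: "\<sigma> \<in> adjoin R a" "\<sigma> \<noteq> 0"
    obtain s' where s': "s' \<in> adjoin R a" "s' * \<sigma> \<in> R" "s' * \<sigma> \<noteq> 0"
      using algebraic_norm[OF R False \<sigma>] by blast
    show "\<exists>\<rho>\<in>R. \<rho> \<noteq> 0 \<and> (\<forall>I. is_ideal R I \<longrightarrow> (\<exists>e. \<tau> ^ e * \<sigma> \<in> adjoin I a) \<longrightarrow> (\<exists>e. (lm * (s * \<tau>)) ^ e * \<rho> \<in> I))"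
    proof (intro bexI[of _ "s' * \<sigma>"] conjI allI impI)
      show "s' * \<sigma> \<noteq> 0" "s' * \<sigma> \<in> R" using s' by auto
      fix I assume I: "is_ideal R I" and "\<exists>e. \<tau> ^ e * \<sigma> \<in> adjoin I a"
      then obtain e where e: "\<tau> ^ e * \<sigma> \<in> adjoin I a" by auto
      define w where "w = (s * \<tau>) ^ e * (s' * \<sigma>)"
      have wR: "w \<in> R" unfolding w_def by (intro mulR is_subring_power[OF R] s s')
      have "s ^ e * s' \<in> adjoin R a"
        using is_subring_adjoin[OF R, of a] s s' is_subring_power[OF is_subring_adjoin[OF R]]
        by (auto simp: is_subring_def)
      then have "(s ^ e * s') * (\<tau> ^ e * \<sigma>) \<in> adjoin I a"
        using is_ideal_adjoin[OF I, of a] e by (auto simp: is_ideal_def)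
      then have "w \<in> adjoin I a" by (simp add: w_def power_mult_distrib mult_ac)
      then obtain p where p: "coeffs_in I p" "w = poly p a" by (auto simp: adjoin_def)
      obtain e' q r where q: "coeffs_in I q" "coeffs_in I r" "r = 0 \<or> degree r < degree m"
        and eq: "smult (lm ^ e') p = q * m + r"
        using pseudo_division_coeffs_in[OF R I m(1,2) p(1)] by (auto simp: lm_def)
      have "poly r a = lm ^ e' * w"
        using arg_cong[OF eq, of "\<lambda>p. poly p a"] m p by simp
      then have "poly (r - [:lm ^ e' * w:]) a = 0" by simp
      moreover have lw: "lm ^ e' * w \<in> R" by (intro mulR is_subring_power[OF R] lm wR)
      have "coeffs_in R (r - [:lm ^ e' * w:])"
        using q I lw R
        by (intro coeffs_in_diff[OF is_ideal_self[OF R]] coeffs_in_const)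
           (auto simp: is_ideal_def is_subring_def coeffs_in_def)
      moreover have "degree (r - [:lm ^ e' * w:]) < degree m"
        using q dm by (intro degree_diff_less) auto
      ultimately have "r = [:lm ^ e' * w:]" using mmin by fastforce
      then have lwI: "lm ^ e' * w \<in> I" using q by (auto simp: coeffs_in_def dest: spec[of _ 0])
      have "lm ^ e * (s * \<tau>) ^ e' \<in> R"
        by (intro mulR is_subring_power[OF R] lm s)
      then have "(lm ^ e * (s * \<tau>) ^ e') * (lm ^ e' * w) \<in> I"
        using lwI I by (auto simp: is_ideal_def)
      then have "(lm * (s * \<tau>)) ^ (e + e') * (s' * \<sigma>) \<in> I"
        by (simp add: w_def power_add power_mult_distrib mult_ac)
      then show "\<exists>e. (lm * (s * \<tau>)) ^ e * (s' * \<sigma>) \<in> I" by blast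
    qed
  qed
qed

fun adjoins :: "'a::comm_ring_1 set \<Rightarrow> 'a list \<Rightarrow> 'a set" where
  "adjoins I [] = I"
| "adjoins I (a # as) = adjoins (adjoin I a) as"

text \<open>The element \<open>l\<close> depends on \<open>\<tau>\<close> only: this lets one choose a center outside its zeros
  that works for all \<open>\<sigma>\<close> simultaneously.\<close>

lemma adjoins_mult_generic:
  fixes as :: "'a::idom list"
  assumes "is_subring R" "\<tau> \<in> adjoins R as" "\<tau> \<noteq> 0"
  shows "\<exists>l\<in>R. l \<noteq> 0 \<and> (\<forall>\<sigma>\<in>adjoins R as. \<sigma> \<noteq> 0 \<longrightarrow> (\<exists>\<rho>\<in>R. \<rho> \<noteq> 0 \<and>
           (\<forall>I. is_ideal R I \<longrightarrow> (\<exists>e. \<tau> ^ e * \<sigma> \<in> adjoins I as) \<longrightarrow> (\<exists>e. l ^ e * \<rho> \<in> I))))"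
  using assms
proof (induction as arbitrary: R \<tau>)
  case Nil
  then show ?case by auto
next
  case (Cons a as)
  obtain l where l: "l \<in> adjoin R a" "l \<noteq> 0"
    and L: "\<And>\<sigma>. \<sigma> \<in> adjoins R (a # as) \<Longrightarrow> \<sigma> \<noteq> 0 \<Longrightarrow> (\<exists>\<rho>\<in>adjoin R a. \<rho> \<noteq> 0 \<and>
           (\<forall>I. is_ideal (adjoin R a) I \<longrightarrow> (\<exists>e. \<tau> ^ e * \<sigma> \<in> adjoins I as) \<longrightarrow> (\<exists>e. l ^ e * \<rho> \<in> I)))"
    using Cons.IH[of "adjoin R a" \<tau>] Cons.prems is_subring_adjoin[OF Cons.prems(1)] by auto
  obtain l' where l': "l' \<in> R" "l' \<noteq> 0"
    and L': "\<And>\<sigma>. \<sigma> \<in> adjoin R a \<Longrightarrow> \<sigma> \<noteq> 0 \<Longrightarrow> (\<exists>\<rho>\<in>R. \<rho> \<noteq> 0 \<and>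
           (\<forall>I. is_ideal R I \<longrightarrow> (\<exists>e. l ^ e * \<sigma> \<in> adjoin I a) \<longrightarrow> (\<exists>e. l' ^ e * \<rho> \<in> I)))"
    using adjoin_mult_generic[OF Cons.prems(1) l] by auto
  show ?case
  proof (rule bexI[OF _ l'(1)], intro conjI ballI impI l'(2))
    fix \<sigma> assume "\<sigma> \<in> adjoins R (a # as)" "\<sigma> \<noteq> 0"
    from L[OF this] obtain \<rho> where \<rho>: "\<rho> \<in> adjoin R a" "\<rho> \<noteq> 0"
      and P: "\<And>I. is_ideal (adjoin R a) I \<Longrightarrow> (\<exists>e. \<tau> ^ e * \<sigma> \<in> adjoins I as) \<Longrightarrow> (\<exists>e. l ^ e * \<rho> \<in> I)"
      by blast
    from L'[OF \<rho>] obtain \<rho>' where "\<rho>' \<in> R" "\<rho>' \<noteq> 0"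
      and P': "\<And>I. is_ideal R I \<Longrightarrow> (\<exists>e. l ^ e * \<rho> \<in> adjoin I a) \<Longrightarrow> (\<exists>e. l' ^ e * \<rho>' \<in> I)"
      by blast
    then show "\<exists>\<rho>\<in>R. \<rho> \<noteq> 0 \<and> (\<forall>I. is_ideal R I \<longrightarrow> (\<exists>e. \<tau> ^ e * \<sigma> \<in> adjoins I (a # as)) \<longrightarrow> (\<exists>e. l' ^ e * \<rho> \<in> I))"
      using P[OF is_ideal_adjoin] by (intro bexI[of _ \<rho>'] conjI allI impI P') auto
  qed
qed

section \<open>Choice of the center\<close>

lemma is_subring_sum: "is_subring R \<Longrightarrow> (\<And>i. i \<in> A \<Longrightarrow> f i \<in> R) \<Longrightarrow> sum f A \<in> R"
  by (rule is_ideal_sum[OF is_ideal_self])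

lemma poly_mem:
  assumes R: "is_subring R" and p: "coeffs_in R p" and a: "a \<in> R"
  shows "poly p a \<in> R"
  unfolding poly_altdef
  by (intro is_subring_sum[OF R]) (use assms is_subring_power[OF R] in \<open>auto simp: coeffs_in_def is_subring_def\<close>)

lemma adjoin_least: "is_subring B \<Longrightarrow> R \<subseteq> B \<Longrightarrow> a \<in> B \<Longrightarrow> adjoin R a \<subseteq> B"
  by (auto simp: adjoin_def intro: poly_mem coeffs_in_mono)

lemma adjoin_shift:
  assumes R: "is_subring R" and c: "c \<in> R"
  shows "adjoin R (a - c) = adjoin R a"
proof -
  have sub: "R \<subseteq> adjoin R b" for b
    using R by (auto simp: is_subring_def intro: adjoin_base)
  have "a - c \<in> adjoin R a" "(a - c) + c \<in> adjoin R (a - c)"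
    using is_subring_adjoin[OF R] adjoin_generator[OF R] sub c
    unfolding is_subring_def by blast+
  then show ?thesis
    using adjoin_least[OF is_subring_adjoin[OF R] sub] by (intro equalityI) auto
qed

lemma coeffs_in_pCons: "coeffs_in I (pCons a p) \<longleftrightarrow> a \<in> I \<and> coeffs_in I p"
  unfolding coeffs_in_def coeff_pCons by (auto split: nat.splits)

lemma coeffs_in_synthetic_div:
  assumes R: "is_subring R" and c: "c \<in> R"
  shows "coeffs_in R p \<Longrightarrow> coeffs_in R (synthetic_div p c)"
proof (induction p)
  case 0
  then show ?case by simp
next
  case (pCons a p)
  then show ?case
    using poly_mem[OF R _ c] by (simp add: coeffs_in_pCons synthetic_div_pCons)
qed

lemma adjoin_nonzero_value:
  assumes R: "is_subring R" and l: "l \<in> adjoin R u" "(l::'a::idom) \<noteq> 0"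
    and C: "infinite C" "C \<subseteq> R"
  shows "\<exists>c\<in>C. \<exists>v\<in>R. \<exists>m\<in>adjoin R u. v \<noteq> 0 \<and> l = v + (u - c) * m"
proof -
  obtain F where F: "coeffs_in R F" "l = poly F u" using l by (auto simp: adjoin_def)
  then have "F \<noteq> 0" using l by auto
  then have "\<not> C \<subseteq> {c. poly F c = 0}"
    using C poly_roots_finite finite_subset by blast
  then obtain c where c: "c \<in> C" "poly F c \<noteq> 0" by blast
  have cR: "c \<in> R" using c C by blast
  have "poly F u = poly ([:- c, 1:] * synthetic_div F c + [:poly F c:]) u"
    using synthetic_div_correct'[of c F] by simp
  then have "l = poly F c + (u - c) * poly (synthetic_div F c) u"
    using F by (simp add: algebra_simps)
  then show ?thesis
    using c poly_mem[OF R F(1) cR] adjoinI[OF coeffs_in_synthetic_div[OF R cR F(1)], of u] by blast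
qed

fun ideal_power :: "'a::comm_ring_1 set \<Rightarrow> 'a \<Rightarrow> 'a \<Rightarrow> nat \<Rightarrow> 'a set" where
  "ideal_power R x u 0 = R"
| "ideal_power R x u (Suc t) = {x * a + u * b | a b. a \<in> ideal_power R x u t \<and> b \<in> ideal_power R x u t}"

lemma ideal_power_SucI: "a \<in> ideal_power R x u t \<Longrightarrow> b \<in> ideal_power R x u t \<Longrightarrow> x * a + u * b \<in> ideal_power R x u (Suc t)"
  by auto

lemma is_ideal_ideal_power:
  assumes R: "is_subring R" and xu: "x \<in> R" "u \<in> R"
  shows "is_ideal R (ideal_power R x u t)"
proof (induction t)
  case 0
  then show ?case using is_ideal_self[OF R] by simp
next
  case (Suc t)
  let ?I = "ideal_power R x u t"
  have I: "0 \<in> ?I" "?I \<subseteq> R"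
    "\<And>a b. a \<in> ?I \<Longrightarrow> b \<in> ?I \<Longrightarrow> a + b \<in> ?I" "\<And>a b. a \<in> ?I \<Longrightarrow> b \<in> ?I \<Longrightarrow> a - b \<in> ?I"
    "\<And>r a. r \<in> R \<Longrightarrow> a \<in> ?I \<Longrightarrow> r * a \<in> ?I"
    using Suc by (auto simp: is_ideal_def)
  have "(x * a + u * b) + (x * a' + u * b') \<in> ideal_power R x u (Suc t)"
    "(x * a + u * b) - (x * a' + u * b') \<in> ideal_power R x u (Suc t)"
    if "a \<in> ?I" "b \<in> ?I" "a' \<in> ?I" "b' \<in> ?I" for a b a' b'
    using ideal_power_SucI[OF I(3) I(3), OF that(1,3,2,4)]
      ideal_power_SucI[OF I(4) I(4), OF that(1,3,2,4)] by (simp_all add: algebra_simps del: ideal_power.simps)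
  moreover have "r * (x * a + u * b) \<in> ideal_power R x u (Suc t)"
    if "r \<in> R" "a \<in> ?I" "b \<in> ?I" for r a b
    using ideal_power_SucI[OF I(5) I(5), OF that(1,2,1,3)] by (simp add: algebra_simps del: ideal_power.simps)
  moreover have "0 \<in> ideal_power R x u (Suc t)"
    using ideal_power_SucI[OF I(1) I(1)] by (simp del: ideal_power.simps)
  moreover have "x * a + u * b \<in> R" if "a \<in> ?I" "b \<in> ?I" for a b
    using that I(2) R xu unfolding is_subring_def by blast
  moreover have "ideal_power R x u (Suc t) = (\<lambda>(a, b). x * a + u * b) ` (?I \<times> ?I)"
    by auto
  ultimately show ?case
    unfolding is_ideal_def by (simp del: ideal_power.simps add: image_subset_iff)
qed

lemma is_ideal_adjoins: "is_ideal R I \<Longrightarrow> is_ideal (adjoins R as) (adjoins I as)"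
  by (induction as arbitrary: R I) (auto intro: is_ideal_adjoin)

lemma adjoin_scale:
  assumes "\<And>y. y \<in> I \<Longrightarrow> r * y \<in> I'" "y \<in> adjoin I a"
  shows "r * y \<in> adjoin I' a"
proof -
  obtain p where "coeffs_in I p" "y = poly p a" using assms by (auto simp: adjoin_def)
  then show ?thesis
    using adjoinI[of I' "smult r p" a] assms by (auto simp: coeffs_in_def)
qed

lemma adjoins_scale:
  assumes "\<And>y. y \<in> I \<Longrightarrow> r * y \<in> I'" "y \<in> adjoins I as"
  shows "r * y \<in> adjoins I' as"
  using assms
proof (induction as arbitrary: I I')
  case (Cons a as)
  show ?case
    using Cons.IH[OF adjoin_scale[OF Cons.prems(1)]] Cons.prems(2) by simp
qed auto

lemma ideal_power_adjoins:
  assumes R: "is_subring R" and xu: "x \<in> R" "u \<in> R"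
  shows "ideal_power (adjoins R as) x u t \<subseteq> adjoins (ideal_power R x u t) as"
proof (induction t)
  case (Suc t)
  have 0: "0 \<in> ideal_power R x u t" using is_ideal_ideal_power[OF R xu] by (auto simp: is_ideal_def)
  have x: "x * y \<in> ideal_power R x u (Suc t)" "u * y \<in> ideal_power R x u (Suc t)" if "y \<in> ideal_power R x u t" for y
    using ideal_power_SucI[OF that 0] ideal_power_SucI[OF 0 that] by (simp_all del: ideal_power.simps)
  have "x * a + u * b \<in> adjoins (ideal_power R x u (Suc t)) as"
    if "a \<in> adjoins (ideal_power R x u t) as" "b \<in> adjoins (ideal_power R x u t) as" for a b
    using adjoins_scale[OF x(1) that(1)] adjoins_scale[OF x(2) that(2)]
      is_ideal_adjoins[OF is_ideal_ideal_power[OF R xu, of "Suc t"], of as]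
    unfolding is_ideal_def by blast
  then show ?case using Suc by auto
qed simp

lemma ideal_power_power:
  assumes "is_subring R" "x \<in> R" "u \<in> R" "j \<in> ideal_power R x u (Suc 0)"
  shows "j ^ t \<in> ideal_power R x u t"
proof (induction t)
  case 0
  then show ?case using assms by (simp add: is_subring_def)
next
  case (Suc t)
  obtain a b where ab: "a \<in> R" "b \<in> R" "j = x * a + u * b" using assms by auto
  have "a * j ^ t \<in> ideal_power R x u t" "b * j ^ t \<in> ideal_power R x u t"
    using is_ideal_ideal_power[OF assms(1-3)] Suc ab by (auto simp: is_ideal_def)
  from ideal_power_SucI[OF this] show ?case by (simp add: ab(3) algebra_simps)
qed

lemma is_ideal_cancel_unit_mod:
  assumes R: "is_subring R" and I: "is_ideal R I" and l: "l \<in> R" and v: "v \<in> R" "v' \<in> R" "v' * v = 1"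
    and j: "(v' * (v - l)) ^ t \<in> I" and \<rho>: "\<rho> \<in> R"
  shows "l ^ e * \<rho> \<in> I \<Longrightarrow> \<rho> \<in> I"
proof (induction e)
  case (Suc e)
  define j where "j = v' * (v - l)"
  define y where "y = l ^ e * \<rho>"
  have jR: "j \<in> R" using R v l by (auto simp: j_def is_subring_def)
  have yR: "y \<in> R" using R \<rho> is_subring_power[OF R l] by (auto simp: y_def is_subring_def)
  have "y - j * y = v' * (l * y)" using v by (simp add: j_def algebra_simps)
  then have base: "y - j * y \<in> I"
    using Suc.prems I v by (auto simp: y_def is_ideal_def mult.assoc)
  have "y - j ^ i * y \<in> I" for i
  proof (induction i)
    case 0
    then show ?case using I by (auto simp: is_ideal_def)
  next
    case (Suc i)
    have "y - j ^ Suc i * y = (y - j ^ i * y) + j ^ i * (y - j * y)"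
      by (simp add: algebra_simps)
    then show ?case
      using Suc base I is_subring_power[OF R jR, of i] unfolding is_ideal_def by metis
  qed
  moreover have "y * j ^ t \<in> I"
    using j yR I by (auto simp: j_def is_ideal_def)
  ultimately have "(y - j ^ t * y) + y * j ^ t \<in> I"
    using I unfolding is_ideal_def by blast
  then have "y \<in> I" by (simp add: algebra_simps)
  then show ?case using Suc.IH by (simp add: y_def)
qed simp

lemma ideal_power_adjoin_coeffs:
  assumes R: "is_subring R" and y: "y \<in> ideal_power (adjoin R u) x u t" and x: "x \<in> R"
  shows "\<exists>p. y = poly p u \<and> (\<forall>n. \<exists>r\<in>R. coeff p n = x ^ (t - n) * r)"
  using y
proof (induction t arbitrary: y)
  case 0
  then show ?case by (auto simp: adjoin_def coeffs_in_def)
next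
  case (Suc t)
  from Suc.prems obtain a b where ab: "a \<in> ideal_power (adjoin R u) x u t" "b \<in> ideal_power (adjoin R u) x u t" "y = x * a + u * b"
    by auto
  from Suc.IH[OF ab(1)] Suc.IH[OF ab(2)] ab(3) obtain p q where y: "y = x * poly p u + u * poly q u"
    and p: "\<And>n. \<exists>r\<in>R. coeff p n = x ^ (t - n) * r" and q: "\<And>n. \<exists>r\<in>R. coeff q n = x ^ (t - n) * r"
    by blast
  have cl: "a + b \<in> R" "a * b \<in> R" "0 \<in> R" if "a \<in> R" "b \<in> R" for a b
    using R that by (auto simp: is_subring_def)
  have "\<exists>r\<in>R. coeff (smult x p + pCons 0 q) n = x ^ (Suc t - n) * r" for n
  proof -
    obtain r where r: "r \<in> R" "coeff p n = x ^ (t - n) * r" using p by blast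
    have "\<exists>r\<in>R. x * coeff p n = x ^ (Suc t - n) * r"
    proof (cases "n \<le> t")
      case True
      then show ?thesis using r by (intro bexI[of _ r]) (auto simp: Suc_diff_le)
    next
      case False
      then show ?thesis using r x cl by (intro bexI[of _ "x * r"]) auto
    qed
    then obtain r1 where r1: "r1 \<in> R" "x * coeff p n = x ^ (Suc t - n) * r1" by blast
    have "\<exists>r\<in>R. coeff (pCons 0 q) n = x ^ (Suc t - n) * r"
    proof (cases n)
      case 0
      then show ?thesis using cl(3)[OF x x] by (intro bexI[of _ 0]) auto
    next
      case (Suc n')
      then show ?thesis using q[of n'] by (auto simp: coeff_pCons)
    qed
    then obtain r2 where r2: "r2 \<in> R" "coeff (pCons 0 q) n = x ^ (Suc t - n) * r2" by blast
    show ?thesis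
      using r1 r2 cl by (intro bexI[of _ "r1 + r2"]) (auto simp: distrib_left)
  qed
  then show ?case
    by (intro exI[of _ "smult x p + pCons 0 q"]) (auto simp: y)
qed

lemma transc_power_dvd:
  assumes R: "is_subring R" and a: "transc R a" and y: "y \<in> adjoin R a"
    and dvd: "\<And>n. \<exists>r\<in>adjoin R a. (y::'a::idom) = a ^ n * r"
  shows "y = 0"
proof (rule ccontr)
  assume "y \<noteq> 0"
  obtain H where H: "coeffs_in R H" "y = poly H a" using y by (auto simp: adjoin_def)
  obtain G where G: "coeffs_in R G" "y = a ^ Suc (degree H) * poly G a"
    using dvd[of "Suc (degree H)"] by (auto simp: adjoin_def)
  have "coeffs_in R (monom 1 (Suc (degree H)) * G)"
    by (intro coeffs_in_mult[OF is_ideal_self[OF R]] coeffs_in_monom G) (use R in \<open>auto simp: is_subring_def\<close>)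
  then have eq: "H = monom 1 (Suc (degree H)) * G"
    using transc_poly_inj[OF R a H(1)] H G by (simp add: poly_monom)
  have "G \<noteq> 0" using \<open>y \<noteq> 0\<close> G by auto
  then show False
    using arg_cong[OF eq, of degree] by (simp add: degree_mult_eq degree_monom_eq monom_eq_0_iff)
qed

lemma ideal_power_Inter_zero:
  assumes k: "is_subring k" and x: "transc k x" and u: "transc (adjoin k x) u"
    and \<rho>: "\<And>t. (\<rho>::'a::idom) \<in> ideal_power (adjoin (adjoin k x) u) x u t"
  shows "\<rho> = 0"
proof -
  let ?R = "adjoin k x"
  note R = is_subring_adjoin[OF k, of x]
  have xR: "x \<in> ?R" using adjoin_generator[OF k] .
  obtain F where F: "coeffs_in ?R F" "\<rho> = poly F u" using \<rho>[of 0] by (auto simp: adjoin_def)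
  have "coeff F n = 0" for n
  proof (rule transc_power_dvd[OF k x])
    show "coeff F n \<in> ?R" using F by (auto simp: coeffs_in_def)
    fix q
    obtain p where p: "\<rho> = poly p u" "\<And>n'. \<exists>r\<in>?R. coeff p n' = x ^ (q + n - n') * r"
      using ideal_power_adjoin_coeffs[OF R \<rho>[of "q + n"] xR] by blast
    have "coeffs_in ?R p"
      unfolding coeffs_in_def
    proof
      fix i
      obtain r where "r \<in> ?R" "coeff p i = x ^ (q + n - i) * r" using p by blast
      then show "coeff p i \<in> ?R" using is_subring_power[OF R xR] R by (auto simp: is_subring_def)
    qed
    then have "F = p" using transc_poly_inj[OF R u F(1)] F p by simp
    then show "\<exists>r\<in>?R. coeff F n = x ^ q * r" using p(2)[of n] by simp
  qed
  then have "F = 0" by (simp add: poly_eq_iff)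
  then show ?thesis using F by simp
qed

proposition center_exists:
  fixes x u \<tau> :: "'a::idom"
  assumes k: "is_subring k" "infinite k" and inv: "\<And>c. c \<in> k \<Longrightarrow> c \<noteq> 0 \<Longrightarrow> \<exists>c'\<in>k. c' * c = 1"
    and x: "\<And>c. c \<in> k \<Longrightarrow> transc k (x - c)"
    and u: "\<And>c. c \<in> k \<Longrightarrow> transc (adjoin k x) (u - c)"
    and as: "adjoins (adjoin (adjoin k x) u) as = UNIV" and \<tau>: "\<tau> \<noteq> 0"
  shows "\<exists>c\<in>k. \<exists>c'\<in>k. \<forall>y. (\<forall>t. \<exists>e. \<tau> ^ e * y \<in> ideal_power UNIV (x - c) (u - c') t) \<longrightarrow> y = 0"
proof -
  define R1 where "R1 = adjoin k x"
  define R0 where "R0 = adjoin R1 u"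
  have R1: "is_subring R1" and R0: "is_subring R0"
    unfolding R0_def R1_def by (intro is_subring_adjoin k)+
  have kR1: "k \<subseteq> R1" and R10: "R1 \<subseteq> R0"
    using k R1 by (auto simp: R0_def R1_def is_subring_def intro: adjoin_base)
  obtain l where l: "l \<in> R0" "l \<noteq> 0"
    and L: "\<And>\<sigma>. \<sigma> \<noteq> 0 \<Longrightarrow> \<exists>\<rho>\<in>R0. \<rho> \<noteq> 0 \<and>
           (\<forall>I. is_ideal R0 I \<longrightarrow> (\<exists>e. \<tau> ^ e * \<sigma> \<in> adjoins I as) \<longrightarrow> (\<exists>e. l ^ e * \<rho> \<in> I))"
    using adjoins_mult_generic[OF R0, of \<tau> as] as \<tau> by (auto simp: R0_def R1_def)
  obtain c' v m where c': "c' \<in> k" "v \<in> R1" "m \<in> R0" "v \<noteq> 0" "l = v + (u - c') * m"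
    using adjoin_nonzero_value[OF R1 _ l(2) k(2) kR1] l(1) unfolding R0_def by metis
  obtain c w m' where c: "c \<in> k" "w \<in> k" "m' \<in> R1" "w \<noteq> 0" "v = w + (x - c) * m'"
    using adjoin_nonzero_value[OF k(1) _ c'(4) k(2) subset_refl] c'(2) unfolding R1_def by metis
  obtain w' where w': "w' \<in> k" "w' * w = 1" using inv c by blast
  define X where "X = x - c"
  define U where "U = u - c'"
  have R1': "R1 = adjoin k X" and R0': "R0 = adjoin R1 U"
    using adjoin_shift[OF k(1) c(1)] adjoin_shift[OF R1] c' kR1 by (auto simp: R1_def R0_def X_def U_def)
  have X: "X \<in> R0" and U: "U \<in> R0"
    using adjoin_generator[OF k(1)] adjoin_generator[OF R1] R10 by (auto simp: R1' R0')
  have "y = 0" if y: "\<And>t. \<exists>e. \<tau> ^ e * y \<in> ideal_power UNIV X U t" for y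
  proof (rule ccontr)
    assume "y \<noteq> 0"
    then obtain \<rho> where \<rho>: "\<rho> \<in> R0" "\<rho> \<noteq> 0"
      and P: "\<And>I. is_ideal R0 I \<Longrightarrow> \<exists>e. \<tau> ^ e * y \<in> adjoins I as \<Longrightarrow> \<exists>e. l ^ e * \<rho> \<in> I"
      using L by metis
    have "\<rho> \<in> ideal_power R0 X U t" for t
    proof -
      note I = is_ideal_ideal_power[OF R0 X U]
      have "\<exists>e. \<tau> ^ e * y \<in> adjoins (ideal_power R0 X U t) as"
        using y[of t] ideal_power_adjoins[OF R0 X U, of as t] as by (auto simp: R0_def R1_def)
      then obtain e where e: "l ^ e * \<rho> \<in> ideal_power R0 X U t" using P[OF I] by blast
      have w: "w \<in> R0" "w' \<in> R0" and m: "m \<in> R0" "m' \<in> R0" using c c' w' kR1 R10 by auto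
      have eq: "w - l = X * (- m') + U * (- m)"
        using c c' by (simp add: X_def U_def)
      have "- m \<in> R0" "- m' \<in> R0"
        using R0 m unfolding is_subring_def by (metis diff_0)+
      then have "w - l \<in> ideal_power R0 X U (Suc 0)"
        unfolding eq by (intro ideal_power_SucI) auto
      then have "w' * (w - l) \<in> ideal_power R0 X U (Suc 0)"
        using I[of "Suc 0"] w unfolding is_ideal_def by blast
      then have "(w' * (w - l)) ^ t \<in> ideal_power R0 X U t"
        using ideal_power_power[OF R0 X U] by blast
      then show ?thesis
        using is_ideal_cancel_unit_mod[OF R0 I l(1) w w'(2) _ \<rho>(1) e] by blast
    qed
    then have "\<rho> = 0"
      using ideal_power_Inter_zero[OF k(1), of X U \<rho>] x[OF c(1)] u[OF c'(1)] R1' R0'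
      by (auto simp: X_def U_def R1_def)
    then show False using \<rho> by simp
  qed
  then show ?thesis using c(1) c'(1) unfolding X_def U_def by blast
qed

section \<open>Order of vanishing and derivations\<close>

definition is_der :: "('a::comm_ring_1 \<Rightarrow> 'a) \<Rightarrow> bool" where
  "is_der d \<longleftrightarrow> (\<forall>x y. d (x + y) = d x + d y) \<and> (\<forall>x y. d (x * y) = x * d y + d x * y)"

lemma is_derD:
  assumes "is_der d"
  shows "d (x + y) = d x + d y" "d (x * y) = x * d y + d x * y" "d 0 = 0" "d 1 = 0"
    "d (- x) = - d x" "d (x - y) = d x - d y"
proof -
  have add: "d (x + y) = d x + d y" and mult: "d (x * y) = x * d y + d x * y" for x y
    using assms by (auto simp: is_der_def)
  show "d (x + y) = d x + d y" "d (x * y) = x * d y + d x * y" by (fact add mult)+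
  show 0: "d 0 = 0" using add[of 0 0] by simp
  show "d 1 = 0" using mult[of 1 1] by simp
  show neg: "d (- x) = - d x" for x
    using add[of x "- x"] 0 by (simp add: eq_neg_iff_add_eq_0 add.commute)
  show "d (x - y) = d x - d y"
    using add[of x "- y"] neg by simp
qed

lemma is_der_sum: "is_der d \<Longrightarrow> d (sum f A) = (\<Sum>i\<in>A. d (f i))"
  by (induction A rule: infinite_finite_induct) (auto simp: is_derD)

lemma is_der_power:
  assumes "is_der d"
  shows "d (a ^ n) = of_nat n * a ^ (n - 1) * d a"
proof (induction n)
  case 0
  then show ?case by (simp add: is_derD[OF assms])
next
  case (Suc n)
  then show ?case by (cases n) (simp_all add: is_derD[OF assms] algebra_simps)
qed

lemma is_der_power_times:
  assumes "is_der d"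
  shows "a * d (a ^ n * y) = a ^ Suc n * d y + of_nat n * d a * (a ^ n * y)"
proof -
  have "a * (of_nat n * a ^ (n - 1)) = of_nat n * a ^ n"
    by (cases n) (simp_all add: mult_ac)
  moreover have "a * d (a ^ n * y) = a ^ Suc n * d y + (a * (of_nat n * a ^ (n - 1))) * (d a * y)"
    by (simp add: is_derD[OF assms] is_der_power[OF assms] algebra_simps)
  ultimately show ?thesis
    by (simp add: mult_ac)
qed

definition bracket :: "('a::comm_ring_1 \<Rightarrow> 'a) \<Rightarrow> ('a \<Rightarrow> 'a) \<Rightarrow> 'a \<Rightarrow> 'a" where
  "bracket d e = (\<lambda>g. d (e g) - e (d g))"

lemma is_der_bracket: "is_der d \<Longrightarrow> is_der e \<Longrightarrow> is_der (bracket d e)"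
  unfolding is_der_def[of "bracket d e"] by (simp add: bracket_def is_derD algebra_simps)

fun nested :: "('a::comm_ring_1 \<Rightarrow> 'a) set \<Rightarrow> nat \<Rightarrow> ('a \<Rightarrow> 'a) set" where
  "nested D 0 = D"
| "nested D (Suc m) = (\<lambda>(d, e). bracket d e) ` (D \<times> nested D m)"

locale adic_pair =
  fixes \<tau> x u \<Delta> :: "'a::idom" and D0 D1 :: "'a \<Rightarrow> 'a"
  assumes der0: "is_der D0" and der1: "is_der D1"
    and D0x: "D0 x = \<Delta>" and D0u: "D0 u = 0" and D1x: "D1 x = 0" and D1u: "D1 u = \<Delta>"
    and \<Delta>_dvd: "\<Delta> dvd \<tau>"
    and of_nat_unit: "\<And>n. n > 0 \<Longrightarrow> (of_nat n :: 'a) dvd 1"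
begin

declare ideal_power.simps(2) [simp del]

abbreviation J :: "nat \<Rightarrow> 'a set" where "J \<equiv> ideal_power UNIV x u"

text \<open>The contraction to the ring of the \<open>t\<close>-th power of the ideal \<open>(x, u)\<close> in the localization at \<open>\<tau>\<close>.\<close>

definition S :: "nat \<Rightarrow> 'a set" where
  "S t = {y. \<exists>e. \<tau> ^ e * y \<in> J t}"

lemma J_ideal: "is_ideal UNIV (J t)"
  by (rule is_ideal_ideal_power) (auto simp: is_subring_def)

lemma J_0: "0 \<in> J t" and J_add: "a \<in> J t \<Longrightarrow> b \<in> J t \<Longrightarrow> a + b \<in> J t"
  and J_diff: "a \<in> J t \<Longrightarrow> b \<in> J t \<Longrightarrow> a - b \<in> J t" and J_mult: "b \<in> J t \<Longrightarrow> a * b \<in> J t"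
  using J_ideal[of t] by (auto simp: is_ideal_def)

lemma J_x: "a \<in> J t \<Longrightarrow> x * a \<in> J (Suc t)" and J_u: "a \<in> J t \<Longrightarrow> u * a \<in> J (Suc t)"
  using ideal_power_SucI[of a UNIV x u t 0] ideal_power_SucI[of 0 UNIV x u t a] J_0 by (auto)

lemma J_SucE:
  assumes "y \<in> J (Suc t)"
  obtains a b where "a \<in> J t" "b \<in> J t" "y = x * a + u * b"
  using assms unfolding ideal_power.simps(2) by blast

lemma J_Suc_subset: "J (Suc t) \<subseteq> J t"
proof (induction t)
  case (Suc t)
  show ?case
  proof
    fix y assume "y \<in> J (Suc (Suc t))"
    then show "y \<in> J (Suc t)"
      by (rule J_SucE) (use Suc in \<open>auto intro!: ideal_power_SucI\<close>)
  qed
qed simp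

lemma S_zero_eq: "S 0 = UNIV"
  by (auto simp: S_def)

lemma J_subset_S: "y \<in> J t \<Longrightarrow> y \<in> S t"
  unfolding S_def by (auto intro: exI[of _ 0])

lemma S_memI: "\<tau> ^ e * y \<in> J t \<Longrightarrow> y \<in> S t"
  unfolding S_def by blast

lemma S_memE: assumes "y \<in> S t" obtains e where "\<tau> ^ e * y \<in> J t"
  using assms unfolding S_def by blast

lemma S_mult: assumes "y \<in> S t" shows "r * y \<in> S t"
proof -
  obtain e where "\<tau> ^ e * y \<in> J t" using assms by (rule S_memE)
  then have "r * (\<tau> ^ e * y) \<in> J t" by (rule J_mult)
  then show ?thesis by (intro S_memI[of e]) (simp add: mult_ac)
qed

lemma S_add: assumes "y \<in> S t" "z \<in> S t" shows "y + z \<in> S t"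
proof -
  obtain e f where "\<tau> ^ e * y \<in> J t" "\<tau> ^ f * z \<in> J t" using assms by (auto simp: S_def)
  then have "\<tau> ^ f * (\<tau> ^ e * y) + \<tau> ^ e * (\<tau> ^ f * z) \<in> J t" by (metis J_add J_mult)
  then show ?thesis by (intro S_memI[of "e + f"]) (simp add: power_add algebra_simps)
qed

lemma S_0: "0 \<in> S t"
  using J_0 J_subset_S by blast

lemma S_minus: "y \<in> S t \<Longrightarrow> - y \<in> S t"
  using S_mult[of y t "- 1"] by simp

lemma S_diff: "y \<in> S t \<Longrightarrow> z \<in> S t \<Longrightarrow> y - z \<in> S t"
  using S_add[of y t "- z"] S_minus by simp

lemma S_sum: "(\<And>i. i \<in> A \<Longrightarrow> f i \<in> S t) \<Longrightarrow> sum f A \<in> S t"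
  by (induction A rule: infinite_finite_induct) (auto intro: S_0 S_add)

lemma S_anti: "t' \<le> t \<Longrightarrow> y \<in> S t \<Longrightarrow> y \<in> S t'"
proof (induction rule: dec_induct)
  case (step n)
  then show ?case using J_Suc_subset[of n] by (auto simp: S_def)
qed

lemma S_cancel_power: assumes "\<tau> ^ e * y \<in> S t" shows "y \<in> S t"
proof -
  obtain f where "\<tau> ^ f * (\<tau> ^ e * y) \<in> J t" using assms by (rule S_memE)
  then show ?thesis by (intro S_memI[of "f + e"]) (simp add: power_add mult.assoc)
qed

lemma S_cancel_dvd: assumes "c dvd \<tau>" "c * y \<in> S t" shows "y \<in> S t"
proof -
  obtain k where "\<tau> = c * k" using assms by (auto simp: dvd_def)
  then have "\<tau> ^ 1 * y \<in> S t" using S_mult[OF assms(2), of k] by (simp add: mult_ac)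
  then show ?thesis by (rule S_cancel_power)
qed

lemma S_cancel_of_nat: assumes "of_nat n * y \<in> S t" "n > 0" shows "y \<in> S t"
proof -
  have "of_nat n dvd \<tau>" using of_nat_unit[OF assms(2)] by (meson dvd_trans one_dvd)
  then show ?thesis using assms S_cancel_dvd by blast
qed

lemma
  assumes "y \<in> S t" shows S_x: "x * y \<in> S (Suc t)" and S_u: "u * y \<in> S (Suc t)"
proof -
  obtain e where e: "\<tau> ^ e * y \<in> J t" using assms by (rule S_memE)
  show "x * y \<in> S (Suc t)"
    using J_x[OF e] by (intro S_memI[of e]) (simp add: mult.left_commute[of x])
  show "u * y \<in> S (Suc t)"
    using J_u[OF e] by (intro S_memI[of e]) (simp add: mult.left_commute[of u])
qed

lemma der_S_transfer:
  assumes d: "is_der d" and J: "\<And>y. y \<in> J t \<Longrightarrow> d y \<in> J t'" "J t \<subseteq> J t'" and y: "y \<in> S t"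
  shows "d y \<in> S t'"
proof -
  obtain e where e: "\<tau> ^ e * y \<in> J t" using y by (auto simp: S_def)
  have "\<tau> * d (\<tau> ^ e * y) - of_nat e * d \<tau> * (\<tau> ^ e * y) \<in> J t'"
    using J_diff[OF J_mult[OF J(1)[OF e]] J_mult[OF subsetD[OF J(2) e]]] .
  then have "\<tau> ^ Suc e * d y \<in> J t'"
    by (simp only: is_der_power_times[OF d] add_diff_cancel_right')
  then show ?thesis unfolding S_def by blast
qed

lemma der_J: "is_der d \<Longrightarrow> y \<in> J (Suc t) \<Longrightarrow> d y \<in> J t"
proof (induction t arbitrary: y)
  case (Suc t)
  obtain a b where ab: "a \<in> J (Suc t)" "b \<in> J (Suc t)" "y = x * a + u * b"
    using Suc.prems(2) by (rule J_SucE)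
  have "d y = (x * d a + u * d b) + (d x * a + d u * b)"
    by (simp add: ab is_derD[OF Suc.prems(1)])
  moreover have "\<dots> \<in> J (Suc t)"
    using J_add[OF ideal_power_SucI[OF Suc.IH Suc.IH, OF Suc.prems(1) ab(1) Suc.prems(1) ab(2)]
        J_add[OF J_mult[OF ab(1)] J_mult[OF ab(2)]]] .
  ultimately show ?case by simp
qed simp

lemma der_S: "is_der d \<Longrightarrow> y \<in> S (Suc t) \<Longrightarrow> d y \<in> S t"
  by (rule der_S_transfer[of d "Suc t" t]) (auto intro: der_J simp: J_Suc_subset)

lemma der_S_diff: "is_der d \<Longrightarrow> y \<in> S t \<Longrightarrow> d y \<in> S (t - 1)"
  by (cases t) (auto simp: S_zero_eq der_S)

lemma der_J_kill: "is_der d \<Longrightarrow> d x = 0 \<Longrightarrow> d u = 0 \<Longrightarrow> y \<in> J t \<Longrightarrow> d y \<in> J t"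
proof (induction t arbitrary: y)
  case (Suc t)
  obtain a b where ab: "a \<in> J t" "b \<in> J t" "y = x * a + u * b"
    using Suc.prems(4) by (rule J_SucE)
  have "d y = x * d a + u * d b"
    using Suc.prems by (simp add: ab is_derD[OF Suc.prems(1)])
  then show ?case
    using Suc.IH[OF Suc.prems(1-3)] ab ideal_power_SucI by metis
qed simp

lemma der_S_kill: "is_der d \<Longrightarrow> d x = 0 \<Longrightarrow> d u = 0 \<Longrightarrow> y \<in> S t \<Longrightarrow> d y \<in> S t"
  by (rule der_S_transfer[of d t t]) (auto intro: der_J_kill)

lemma euler_J: "y \<in> J t \<Longrightarrow> x * D0 y + u * D1 y - of_nat t * \<Delta> * y \<in> J (Suc t)"
proof (induction t arbitrary: y)
  case 0
  show ?case using ideal_power_SucI[of "D0 y" UNIV x u 0 "D1 y"] by simp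
next
  case (Suc t)
  obtain a b where ab: "a \<in> J t" "b \<in> J t" "y = x * a + u * b"
    using Suc.prems by (rule J_SucE)
  have "x * D0 y + u * D1 y - of_nat (Suc t) * \<Delta> * y =
    x * (x * D0 a + u * D1 a - of_nat t * \<Delta> * a) + u * (x * D0 b + u * D1 b - of_nat t * \<Delta> * b)"
    by (simp add: ab is_derD[OF der0] is_derD[OF der1] D0x D0u D1x D1u algebra_simps)
  then show ?case
    using Suc.IH[OF ab(1)] Suc.IH[OF ab(2)] ideal_power_SucI by metis
qed

text \<open>Euler's identity: \<open>x * D0 + u * D1\<close> acts on \<open>S t\<close> modulo \<open>S (Suc t)\<close> as multiplication by \<open>t * \<Delta>\<close>.\<close>

lemma S_SucI:
  assumes y: "y \<in> S t" "D0 y \<in> S t" "D1 y \<in> S t" and t: "t \<ge> 1"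
  shows "y \<in> S (Suc t)"
proof -
  obtain e where e: "\<tau> ^ e * y \<in> J t" using y by (auto simp: S_def)
  define z where "z = \<tau> ^ e * y"
  have z: "z \<in> J t" using e by (simp add: z_def)
  let ?E = "\<lambda>y. x * D0 y + u * D1 y"
  have "\<tau> * (?E z - of_nat t * \<Delta> * z) \<in> S (Suc t)"
    using euler_J[OF z] by (intro S_mult J_subset_S)
  moreover have "of_nat e * (x * (D0 \<tau> * z) + u * (D1 \<tau> * z)) \<in> S (Suc t)"
    using z by (intro S_mult S_add S_x S_u) (auto intro: J_subset_S)
  moreover have "\<tau> ^ Suc e * ?E y \<in> S (Suc t)"
    using y by (intro S_mult S_add S_x S_u)
  moreover have "of_nat t * (\<Delta> * (\<tau> ^ Suc e * y)) = \<tau> ^ Suc e * ?E y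
    + of_nat e * (x * (D0 \<tau> * z) + u * (D1 \<tau> * z)) - \<tau> * (?E z - of_nat t * \<Delta> * z)"
  proof -
    have "\<tau> * ?E z = x * (\<tau> * D0 z) + u * (\<tau> * D1 z)" by (simp add: algebra_simps)
    also have "\<dots> = \<tau> ^ Suc e * ?E y + of_nat e * (x * (D0 \<tau> * z) + u * (D1 \<tau> * z))"
      unfolding z_def is_der_power_times[OF der0] is_der_power_times[OF der1] by (simp add: algebra_simps)
    finally show ?thesis by (simp add: z_def algebra_simps)
  qed
  ultimately have "of_nat t * (\<Delta> * (\<tau> ^ Suc e * y)) \<in> S (Suc t)"
    by (metis S_add S_diff)
  then show ?thesis
    using S_cancel_of_nat S_cancel_dvd[OF \<Delta>_dvd] S_cancel_power t
    by (metis less_eq_Suc_le One_nat_def)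
qed

definition form :: "nat \<Rightarrow> (nat \<Rightarrow> 'a) \<Rightarrow> 'a" where
  "form t c = (\<Sum>i\<le>t. x ^ i * u ^ (t - i) * c i)"

lemma form_diff: "form t c - form t c' = form t (\<lambda>i. c i - c' i)"
  and form_add: "form t c + form t c' = form t (\<lambda>i. c i + c' i)"
  by (simp_all add: form_def sum.distrib sum_subtractf algebra_simps)

lemma x_form: "x * form t c = form (Suc t) (\<lambda>i. if i = 0 then 0 else c (i - 1))"
  by (simp add: form_def sum.atMost_Suc_shift sum_distrib_left mult_ac del: sum.atMost_Suc)

lemma u_form: "u * form t c = form (Suc t) (\<lambda>i. if i \<le> t then c i else 0)"
  by (simp add: form_def sum_distrib_left Suc_diff_le mult_ac)

lemma xs_form: "x ^ s * form t c = form (t + s) (\<lambda>i. if i < s then 0 else c (i - s))"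
proof (induction s)
  case (Suc s)
  have "x ^ Suc s * form t c = form (t + Suc s) (\<lambda>i. if i = 0 then 0 else if i - 1 < s then 0 else c (i - 1 - s))"
    using x_form[of "t + s"] by (simp add: Suc mult.assoc)
  also have "(\<lambda>i. if i = 0 then 0 else if i - 1 < s then 0 else c (i - 1 - s)) = (\<lambda>i. if i < Suc s then 0 else c (i - Suc s))"
    by (auto simp: fun_eq_iff)
  finally show ?case .
qed simp

lemma us_form: "u ^ s * form t c = form (t + s) (\<lambda>i. if i \<le> t then c i else 0)"
proof (induction s)
  case 0
  then show ?case by (simp add: form_def)
next
  case (Suc s)
  have "u ^ Suc s * form t c = form (t + Suc s) (\<lambda>i. if i \<le> t + s then if i \<le> t then c i else 0 else 0)"
    using u_form[of "t + s"] by (simp add: Suc mult.assoc)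
  also have "(\<lambda>i. if i \<le> t + s then if i \<le> t then c i else 0 else 0) = (\<lambda>i. if i \<le> t then c i else 0)"
    by (auto simp: fun_eq_iff)
  finally show ?case .
qed

lemma J_form: "y \<in> J t \<Longrightarrow> \<exists>c. y = form t c"
proof (induction t arbitrary: y)
  case 0
  then show ?case by (intro exI[of _ "\<lambda>_. y"]) (simp add: form_def)
next
  case (Suc t)
  then obtain c c' where "y = x * form t c + u * form t c'" by (metis J_SucE)
  then show ?case by (auto simp: x_form u_form form_add)
qed

lemma monomial_S: "y \<in> S t \<Longrightarrow> x ^ i * u ^ j * y \<in> S (i + j + t)"
proof (induction i)
  case 0
  then show ?case
  proof (induction j)
    case (Suc j)
    then show ?case using S_u[of "u ^ j * y" "j + t"] by (simp add: mult.assoc)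
  qed simp
next
  case (Suc i)
  then show ?case using S_x[of "x ^ i * u ^ j * y" "i + j + t"] by (simp add: mult.assoc)
qed

lemma form_S: "(\<And>i. i \<le> t \<Longrightarrow> c i \<in> S m) \<Longrightarrow> form t c \<in> S (t + m)"
  unfolding form_def
proof (intro S_sum)
  fix i assume "i \<in> {..t}"
  then show "x ^ i * u ^ (t - i) * c i \<in> S (t + m)"
    if "\<And>i. i \<le> t \<Longrightarrow> c i \<in> S m" using monomial_S[OF that, of i i "t - i"] by simp
qed

lemma D0_form: "D0 (form (Suc t) c) =
    form t (\<lambda>i. of_nat (Suc i) * (\<Delta> * c (Suc i))) + form (Suc t) (\<lambda>i. D0 (c i))"
proof -
  have "D0 (x ^ i * u ^ j * a) = of_nat i * x ^ (i - 1) * \<Delta> * u ^ j * a + x ^ i * u ^ j * D0 a" for i j a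
    by (simp add: is_derD[OF der0] is_der_power[OF der0] D0x D0u algebra_simps)
  then have "D0 (form (Suc t) c) =
      (\<Sum>i\<le>Suc t. of_nat i * x ^ (i - 1) * \<Delta> * u ^ (Suc t - i) * c i) + form (Suc t) (\<lambda>i. D0 (c i))"
    by (simp add: form_def is_der_sum[OF der0] sum.distrib del: sum.atMost_Suc)
  also have "(\<Sum>i\<le>Suc t. of_nat i * x ^ (i - 1) * \<Delta> * u ^ (Suc t - i) * c i)
      = form t (\<lambda>i. of_nat (Suc i) * (\<Delta> * c (Suc i)))"
    by (simp add: form_def sum.atMost_Suc_shift mult_ac del: sum.atMost_Suc of_nat_Suc)
  finally show ?thesis .
qed

lemma D1_form: "D1 (form (Suc t) c) =
    form t (\<lambda>i. of_nat (Suc t - i) * (\<Delta> * c i)) + form (Suc t) (\<lambda>i. D1 (c i))"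
proof -
  have "D1 (x ^ i * u ^ j * a) = of_nat j * u ^ (j - 1) * \<Delta> * x ^ i * a + x ^ i * u ^ j * D1 a" for i j a
    by (simp add: is_derD[OF der1] is_der_power[OF der1] D1x D1u algebra_simps)
  then have "D1 (form (Suc t) c) =
      (\<Sum>i\<le>Suc t. of_nat (Suc t - i) * u ^ (Suc t - i - 1) * \<Delta> * x ^ i * c i) + form (Suc t) (\<lambda>i. D1 (c i))"
    by (simp add: form_def is_der_sum[OF der1] sum.distrib del: sum.atMost_Suc)
  also have "(\<Sum>i\<le>Suc t. of_nat (Suc t - i) * u ^ (Suc t - i - 1) * \<Delta> * x ^ i * c i)
      = form t (\<lambda>i. of_nat (Suc t - i) * (\<Delta> * c i))"
    by (simp add: form_def mult_ac diff_commute[of "Suc t"] del: of_nat_Suc)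
  finally show ?thesis .
qed

lemma quasi_regular: "form t c \<in> S (Suc t) \<Longrightarrow> i \<le> t \<Longrightarrow> c i \<in> S 1"
proof (induction t arbitrary: c i)
  case 0
  then show ?case by (simp add: form_def)
next
  case (Suc t)
  have F: "form (Suc t) c' \<in> S (Suc t)" for c'
    using form_S[of "Suc t" c' 0] by (simp add: S_zero_eq)
  have "form t (\<lambda>i. of_nat (Suc i) * (\<Delta> * c (Suc i))) \<in> S (Suc t)"
    using S_diff[OF der_S[OF der0 Suc.prems(1)] F[of "\<lambda>i. D0 (c i)"]] by (simp only: D0_form add_diff_cancel_right')
  from Suc.IH[OF this] have 1: "c (Suc i) \<in> S 1" if "i \<le> t" for i
    using that S_cancel_of_nat S_cancel_dvd[OF \<Delta>_dvd] by blast
  have "form t (\<lambda>i. of_nat (Suc t - i) * (\<Delta> * c i)) \<in> S (Suc t)"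
    using S_diff[OF der_S[OF der1 Suc.prems(1)] F[of "\<lambda>i. D1 (c i)"]] by (simp only: D1_form add_diff_cancel_right')
  from Suc.IH[OF this, of 0] have "c 0 \<in> S 1"
    using S_cancel_of_nat[of "Suc t" "\<Delta> * c 0"] S_cancel_dvd[OF \<Delta>_dvd] by simp
  then show ?case using 1 Suc.prems(2) by (cases i) auto
qed

lemma order_step:
  assumes a: "a \<in> S t" and b: "b \<in> S t" and rel: "x ^ s * a + u ^ s * b = 0" and s: "s \<ge> 2"
    and closed: "s \<le> t \<Longrightarrow> D0 b - D1 a \<in> S t"
  shows "a \<in> S (Suc t) \<and> b \<in> S (Suc t)"
proof -
  obtain e f where "\<tau> ^ e * a \<in> J t" "\<tau> ^ f * b \<in> J t" using a b by (auto simp: S_def)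
  then have "\<tau> ^ f * (\<tau> ^ e * a) \<in> J t" "\<tau> ^ e * (\<tau> ^ f * b) \<in> J t" by (metis J_mult)+
  then obtain \<alpha> \<beta> where \<alpha>: "\<tau> ^ (e + f) * a = form t \<alpha>" and \<beta>: "\<tau> ^ (e + f) * b = form t \<beta>"
    using J_form by (metis mult.assoc power_add add.commute)
  have "x ^ s * form t \<alpha> + u ^ s * form t \<beta> = \<tau> ^ (e + f) * (x ^ s * a + u ^ s * b)"
    unfolding \<alpha>[symmetric] \<beta>[symmetric] by (simp add: algebra_simps)
  then have "form (t + s) (\<lambda>i. (if i < s then 0 else \<alpha> (i - s)) + (if i \<le> t then \<beta> i else 0)) = 0"
    using rel by (simp add: xs_form us_form form_add)
  then have R: "(if i < s then 0 else \<alpha> (i - s)) + (if i \<le> t then \<beta> i else 0) \<in> S 1" if "i \<le> t + s" for i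
    using quasi_regular[of "t + s" "\<lambda>i. (if i < s then 0 else \<alpha> (i - s)) + (if i \<le> t then \<beta> i else 0)" i]
      that S_0[of "Suc (t + s)"] by simp
  have top: "\<alpha> i \<in> S 1" if "i \<le> t" "i + s > t" for i
    using R[of "i + s"] that by simp
  have "(\<forall>i\<le>t. \<alpha> i \<in> S 1) \<and> (\<forall>i\<le>t. \<beta> i \<in> S 1)"
  proof (cases "t < s")
    case True
    then have "\<beta> i \<in> S 1" if "i \<le> t" for i using R[of i] that by simp
    then show ?thesis using top True by auto
  next
    case False
    obtain t' where t': "t = Suc t'" using False s by (cases t) auto
    have "D0 (\<tau> ^ n * b) - D1 (\<tau> ^ n * a) \<in> S t" for n
    proof -
      have "D0 (\<tau> ^ n * b) - D1 (\<tau> ^ n * a) = \<tau> ^ n * (D0 b - D1 a) + D0 (\<tau> ^ n) * b - D1 (\<tau> ^ n) * a"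
        by (simp add: is_derD[OF der0] is_derD[OF der1] algebra_simps)
      then show ?thesis using closed False a b by (auto intro!: S_add S_diff S_mult)
    qed
    from this[of "e + f"] have "D0 (form t \<beta>) - D1 (form t \<alpha>) \<in> S t" by (simp only: \<alpha> \<beta>)
    moreover have "form t (\<lambda>i. D0 (\<beta> i)) - form t (\<lambda>i. D1 (\<alpha> i)) \<in> S t"
      using form_S[of t _ 0] S_zero_eq by (intro S_diff) auto
    ultimately have "(D0 (form t \<beta>) - D1 (form t \<alpha>)) - (form t (\<lambda>i. D0 (\<beta> i)) - form t (\<lambda>i. D1 (\<alpha> i))) \<in> S t"
      by (rule S_diff)
    then have "form t' (\<lambda>i. of_nat (Suc i) * (\<Delta> * \<beta> (Suc i)) - of_nat (t - i) * (\<Delta> * \<alpha> i)) \<in> S (Suc t')"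
      unfolding t' D0_form D1_form form_diff[symmetric] by (simp only: algebra_simps) (simp add: algebra_simps)
    from quasi_regular[OF this] have "of_nat (Suc i) * (\<Delta> * \<beta> (Suc i)) - of_nat (t - i) * (\<Delta> * \<alpha> i) \<in> S 1"
      if "i \<le> t'" for i using that .
    then have "\<Delta> * (of_nat (Suc i) * \<beta> (Suc i) - of_nat (t - i) * \<alpha> i) \<in> S 1" if "i \<le> t'" for i
      using that by (simp only: right_diff_distrib mult.left_commute[of \<Delta>])
    then have C: "of_nat (Suc i) * \<beta> (Suc i) - of_nat (t - i) * \<alpha> i \<in> S 1" if "i \<le> t'" for i
      using that S_cancel_dvd[OF \<Delta>_dvd] by blast
    have \<beta>S: "\<beta> (Suc i) \<in> S 1" if "i \<le> t'" "\<alpha> i \<in> S 1" for i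
      using S_add[OF C[OF that(1)] S_mult[OF that(2), of "of_nat (t - i)"]] S_cancel_of_nat[of "Suc i"]
      by simp
    have \<alpha>S: "\<alpha> i \<in> S 1" if "i \<le> t" for i
      using that
    proof (induction "t - i" arbitrary: i rule: less_induct)
      case less
      show ?case
      proof (cases "i + s > t")
        case True
        then show ?thesis using top less.prems by blast
      next
        case F: False
        define k where "k = i + s - 1"
        have k: "Suc k = i + s" "k \<le> t'" "k > i" "k \<le> t" using F s t' by (auto simp: k_def)
        have "\<beta> (i + s) \<in> S 1" using \<beta>S[of k] less.hyps[of k] k less.prems by simp
        moreover have "\<alpha> i + \<beta> (i + s) \<in> S 1" using R[of "i + s"] F by simp
        ultimately show ?thesis using S_diff by fastforce
      qed
    qed
    have "\<beta> 0 \<in> S 1" using R[of 0] s by simp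
    then have "\<beta> i \<in> S 1" if "i \<le> t" for i
      using that \<beta>S \<alpha>S t' by (cases i) auto
    then show ?thesis using \<alpha>S by blast
  qed
  then have "form t \<alpha> \<in> S (Suc t)" "form t \<beta> \<in> S (Suc t)" using form_S[of t _ 1] by auto
  then show ?thesis using S_cancel_power \<alpha> \<beta> by metis
qed

abbreviation W :: "nat \<Rightarrow> ('a \<Rightarrow> 'a) set" where "W \<equiv> nested {D0, D1}"

lemma W_der: "e \<in> W m \<Longrightarrow> is_der e"
  by (induction m arbitrary: e) (auto intro: der0 der1 is_der_bracket)

lemma W_order:
  assumes "D0 g \<in> S t" "D1 g \<in> S t"
  shows "e \<in> W m \<Longrightarrow> e g \<in> S (t - m)"
proof (induction m arbitrary: e)
  case 0
  then show ?case using assms by auto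
next
  case (Suc m)
  then obtain d e' where e: "d = D0 \<or> d = D1" "e' \<in> W m" "e = bracket d e'" by auto
  have "d (e' g) \<in> S (t - Suc m)"
    using der_S_diff[of d "e' g" "t - m"] Suc.IH[OF e(2)] e(1) der0 der1 by auto
  moreover have "e' (d g) \<in> S (t - 1)"
    using der_S_diff[OF W_der[OF e(2)], of "d g" t] e(1) assms by auto
  then have "e' (d g) \<in> S (t - Suc m)" by (rule S_anti[rotated]) simp
  ultimately show ?case by (auto simp: e(3) bracket_def intro: S_diff)
qed

lemma kernel_order:
  assumes s: "s \<ge> 2" "s > l" and g: "x ^ s * D0 g + u ^ s * D1 g = 0"
    and W: "\<And>e t. e \<in> W (Suc l) \<Longrightarrow> (\<And>m b. m \<le> l \<Longrightarrow> b \<in> W m \<Longrightarrow> b g \<in> S t) \<Longrightarrow> e g \<in> S t"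
  shows "D0 g \<in> S t \<and> D1 g \<in> S t"
proof (induction t)
  case 0
  then show ?case by (simp add: S_zero_eq)
next
  case (Suc t)
  then have t: "D0 g \<in> S t" "D1 g \<in> S t" by auto
  have "D0 (D1 g) - D1 (D0 g) \<in> S t" if st: "s \<le> t"
  proof -
    define P where "P r \<longleftrightarrow> (\<forall>m\<le>l. \<forall>b\<in>W m. b g \<in> S r)" for r
    have br: "bracket d b g \<in> S r" if P: "P r" and d: "d \<in> {D0, D1}" and b: "b \<in> W m" "m \<le> l" for r d b m
    proof -
      have "bracket d b \<in> W (Suc m)" using d b(1) by auto
      then show ?thesis
        using P W[of "bracket d b" r] b(2) unfolding P_def
        by (metis le_antisym not_less_eq_eq)
    qed
    have "t - l \<le> t" by simp
    then have "P t"
    proof (induction rule: dec_induct)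
      case base
      then show ?case
        unfolding P_def using W_order[OF t] S_anti[of "t - l"] by (meson diff_le_mono2)
    next
      case (step r)
      show ?case
        unfolding P_def
      proof (intro allI impI ballI)
        fix m e assume m: "m \<le> l" and e: "e \<in> W m"
        note de = W_der[OF e]
        \<comment> \<open>\<open>n\<close> kills \<open>x\<close> and \<open>u\<close>, hence does not lower the order.\<close>
        define n where "n = (\<lambda>y. \<Delta> * e y - e x * D0 y - e u * D1 y)"
        have n: "is_der n" "n x = 0" "n u = 0"
          by (auto simp: is_der_def n_def is_derD[OF de] is_derD[OF der0] is_derD[OF der1]
              D0x D0u D1x D1u algebra_simps)
        have eg: "e g \<in> S r" using step.IH m e by (auto simp: P_def)
        have tr: "D0 g \<in> S r" "D1 g \<in> S r" "D0 g \<in> S (Suc r)" "D1 g \<in> S (Suc r)"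
          using S_anti[OF _ t(1)] S_anti[OF _ t(2)] step.hyps by auto
        have dn: "d (n g) \<in> S r" if d: "d \<in> {D0, D1}" for d
        proof -
          have dd: "is_der d" using d der0 der1 by auto
          have "d (n g) = n (d g) + d \<Delta> * e g + \<Delta> * bracket d e g - d (e x) * D0 g - d (e u) * D1 g
            - e x * bracket d D0 g - e u * bracket d D1 g"
            by (simp add: n_def bracket_def is_derD[OF dd] algebra_simps)
          moreover have "n (d g) \<in> S r"
            using der_S_kill[OF n] d tr by auto
          moreover have "bracket d D0 g \<in> S r" "bracket d D1 g \<in> S r"
            using br[OF step.IH d, of _ 0] by auto
          ultimately show ?thesis
            using eg tr br[OF step.IH d e m] by (auto intro!: S_add S_diff S_mult)
        qed
        have "n g \<in> S r"
          unfolding n_def using eg tr by (intro S_diff S_mult)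
        then have "n g \<in> S (Suc r)"
          using dn step.hyps st s by (intro S_SucI) auto
        then have "n g + e x * D0 g + e u * D1 g \<in> S (Suc r)"
          using tr by (intro S_add S_mult)
        then have "\<Delta> * e g \<in> S (Suc r)" by (simp add: n_def)
        then show "e g \<in> S (Suc r)" by (rule S_cancel_dvd[OF \<Delta>_dvd])
      qed
    qed
    from br[OF this, of D0 D1 0] show ?thesis by (simp add: bracket_def)
  qed
  then show ?case using order_step[OF t g s(1)] by blast
qed

end

section \<open>Families of derivations\<close>

definition fun_scale :: "'a::comm_ring_1 \<Rightarrow> ('b \<Rightarrow> 'a) \<Rightarrow> 'b \<Rightarrow> 'a" where
  "fun_scale c f = (\<lambda>s. c * f s)"

interpretation fun_module: module fun_scale
  by unfold_locales (auto simp: fun_scale_def fun_eq_iff algebra_simps)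

lemma fun_module_span_induct [consumes 1, case_names zero add scale base]:
  assumes "w \<in> fun_module.span B" "P 0" "\<And>f g. P f \<Longrightarrow> P g \<Longrightarrow> P (f + g)"
    "\<And>c f. P f \<Longrightarrow> P (fun_scale c f)" "\<And>b. b \<in> B \<Longrightarrow> P b"
  shows "P w"
  using assms(1)
proof (rule fun_module.span_induct)
  show "fun_module.subspace {f. P f}"
    by (rule fun_module.subspaceI) (use assms(2-4) in auto)
qed (fact assms(5))

lemma finite_generic_generators:
  fixes V :: "('b \<Rightarrow> 'a::idom) set"
  assumes "finite X"
  shows "\<exists>B\<subseteq>V. finite B \<and> (\<forall>v\<in>V. \<exists>c w. c \<noteq> 0 \<and> w \<in> fun_module.span B \<and> (\<forall>s\<in>X. c * v s = w s))"
  using assms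
proof (induction X arbitrary: V rule: finite_induct)
  case empty
  then show ?case
    using fun_module.span_zero by (intro exI[of _ "{}"]) (auto intro: exI[of _ 1])
next
  case (insert s X)
  have vanish: "w s = 0" if "w \<in> fun_module.span B" "\<And>b. b \<in> B \<Longrightarrow> b s = 0" for w :: "'b \<Rightarrow> 'a" and B
    using that(1) by (induction rule: fun_module_span_induct) (auto simp: fun_scale_def that(2))
  show ?case
  proof (cases "\<forall>v\<in>V. v s = 0")
    case True
    obtain B where B: "B \<subseteq> V" "finite B"
      "\<And>v. v \<in> V \<Longrightarrow> \<exists>c w. c \<noteq> 0 \<and> w \<in> fun_module.span B \<and> (\<forall>s\<in>X. c * v s = w s)"
      using insert.IH[of V] by blast
    have "\<exists>c w. c \<noteq> 0 \<and> w \<in> fun_module.span B \<and> (\<forall>t\<in>insert s X. c * v t = w t)" if v: "v \<in> V" for v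
    proof -
      obtain c w where "c \<noteq> 0" "w \<in> fun_module.span B" "\<forall>t\<in>X. c * v t = w t" using B(3) v by blast
      moreover have "w s = 0" using vanish calculation(2) B(1) True by blast
      ultimately show ?thesis using True v by (intro exI[of _ c] exI[of _ w]) auto
    qed
    then show ?thesis using B by blast
  next
    case False
    then obtain v0 where v0: "v0 \<in> V" "v0 s \<noteq> 0" by blast
    define f where "f v = fun_scale (v0 s) v - fun_scale (v s) v0" for v
    obtain B' where B': "B' \<subseteq> f ` V" "finite B'"
      "\<And>v. v \<in> f ` V \<Longrightarrow> \<exists>c w. c \<noteq> 0 \<and> w \<in> fun_module.span B' \<and> (\<forall>s\<in>X. c * v s = w s)"
      using insert.IH[of "f ` V"] by blast
    then obtain C where C: "C \<subseteq> V" "finite C" "B' = f ` C" by (metis finite_subset_image)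
    let ?B = "insert v0 C"
    have "\<exists>c w. c \<noteq> 0 \<and> w \<in> fun_module.span ?B \<and> (\<forall>t\<in>insert s X. c * v t = w t)" if v: "v \<in> V" for v
    proof -
      obtain c w where c: "c \<noteq> 0" and w: "w \<in> fun_module.span B'" and eq: "\<forall>t\<in>X. c * f v t = w t"
        using B'(3) v by blast
      have "w s = 0" using w by (rule vanish) (auto simp: C f_def fun_scale_def)
      have "B' \<subseteq> fun_module.span ?B"
        unfolding C(3) f_def
        by (intro image_subsetI fun_module.span_diff fun_module.span_scale fun_module.span_base) auto
      then have "w \<in> fun_module.span ?B"
        using w fun_module.span_minimal fun_module.subspace_span by blast
      then have "w + fun_scale (c * v s) v0 \<in> fun_module.span ?B"
        by (rule fun_module.span_add[OF _ fun_module.span_scale[OF fun_module.span_base]]) auto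
      moreover have "c * v0 s * v t = (w + fun_scale (c * v s) v0) t" if "t \<in> insert s X" for t
        using that eq \<open>w s = 0\<close> by (auto simp: f_def fun_scale_def algebra_simps)
      ultimately show ?thesis using c v0 by (metis mult_eq_0_iff)
    qed
    then show ?thesis using C v0 by (intro exI[of _ ?B]) auto
  qed
qed

definition der_over :: "'a::comm_ring_1 set \<Rightarrow> ('a \<Rightarrow> 'a) \<Rightarrow> bool" where
  "der_over k d \<longleftrightarrow> is_der d \<and> (\<forall>c\<in>k. d c = 0)"

lemma der_over_bracket: "der_over k d \<Longrightarrow> der_over k e \<Longrightarrow> der_over k (bracket d e)"
  by (auto simp: der_over_def is_der_bracket) (auto simp: bracket_def is_derD)

lemma der_over_lincomb:
  "der_over k d \<Longrightarrow> der_over k e \<Longrightarrow> der_over k (\<lambda>g. a * d g + b * e g)"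
  by (auto simp: der_over_def is_der_def algebra_simps)

lemma der_over_nested: "(\<And>d. d \<in> D \<Longrightarrow> der_over k d) \<Longrightarrow> e \<in> nested D m \<Longrightarrow> der_over k e"
  by (induction m arbitrary: e) (auto intro: der_over_bracket)

lemma finite_nested: "finite D \<Longrightarrow> finite (nested D m)"
  by (induction m) auto

lemma der_over_span:
  assumes "w \<in> fun_module.span B" "\<And>b. b \<in> B \<Longrightarrow> der_over k b"
  shows "der_over k w"
  using assms(1)
  by (induction rule: fun_module_span_induct)
    (auto simp: assms(2), auto simp: der_over_def is_der_def fun_scale_def algebra_simps)

lemma der_over_poly:
  fixes a :: "'a::idom"
  assumes d: "der_over k d" and p: "coeffs_in k p"
  shows "d (poly p a) = poly (pderiv p) a * d a"
  using p
proof (induction p)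
  case 0
  then show ?case using d by (simp add: der_over_def is_derD)
next
  case (pCons c p)
  then have "d c = 0" "d (poly p a) = poly (pderiv p) a * d a"
    using d by (auto simp: coeffs_in_pCons der_over_def)
  then show ?case
    using d by (simp add: der_over_def is_derD pderiv_pCons algebra_simps)
qed

lemma der_over_adjoin: "der_over k d \<Longrightarrow> d a = 0 \<Longrightarrow> der_over (adjoin k a) d"
  for a :: "'a::idom"
  using der_over_poly[of k d _ a] by (auto simp: der_over_def adjoin_def)

lemma der_over_transc:
  fixes a :: "'a::idom"
  assumes k: "is_subring k" and d: "der_over k d" "d a \<noteq> 0"
    and char0: "\<And>n. n > 0 \<Longrightarrow> (of_nat n :: 'a) \<noteq> 0"
  shows "transc k a"
proof (rule ccontr)
  assume "\<not> transc k a"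
  then obtain m where m: "coeffs_in k m" "m \<noteq> 0" "poly m a = 0"
    and mmin: "\<And>p. coeffs_in k p \<Longrightarrow> poly p a = 0 \<Longrightarrow> degree p < degree m \<Longrightarrow> p = 0"
    using not_transc_minimal by metis
  have deg: "degree m > 0" using m by (auto elim!: degree_eq_zeroE intro!: gr0I)
  have nat: "of_nat n \<in> k" for n using k by (induction n) (auto simp: is_subring_def)
  have "coeffs_in k (pderiv m)"
    using m(1) k nat unfolding coeffs_in_def coeff_pderiv is_subring_def by blast
  moreover have "poly (pderiv m) a = 0"
    using der_over_poly[OF d(1) m(1), of a] m(3) d by (simp add: der_over_def is_derD)
  moreover have "degree (pderiv m) < degree m"
  proof -
    have "degree (pderiv m) \<le> degree m - 1"
      by (rule degree_le) (auto simp: coeff_pderiv coeff_eq_0)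
    then show ?thesis using deg by linarith
  qed
  ultimately have "pderiv m = 0" using mmin by blast
  then have "coeff (pderiv m) (degree m - 1) = 0" by simp
  then show False using deg m(2) char0[of "degree m"] by (simp add: coeff_pderiv)
qed

lemma is_subring_adjoins: "is_subring R \<Longrightarrow> is_subring (adjoins R as)"
  by (induction as arbitrary: R) (auto intro: is_subring_adjoin)

lemma adjoins_superset: "is_subring R \<Longrightarrow> R \<subseteq> adjoins R as"
proof (induction as arbitrary: R)
  case (Cons a as)
  have "R \<subseteq> adjoin R a" using Cons.prems by (auto simp: is_subring_def intro: adjoin_base)
  then show ?case using Cons.IH[OF is_subring_adjoin[OF Cons.prems, of a]] by auto
qed simp

lemma adjoins_generators: "is_subring R \<Longrightarrow> set as \<subseteq> adjoins R as"
proof (induction as arbitrary: R)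
  case (Cons a as)
  note sub = is_subring_adjoin[OF Cons.prems, of a]
  show ?case
    using Cons.IH[OF sub] adjoins_superset[OF sub, of as] adjoin_generator[OF Cons.prems, of a] by auto
qed simp

text \<open>Here \<open>k\<close> is the image of the ground field in the algebra.\<close>

locale finite_type_domain =
  fixes k X :: "'a::idom set"
  assumes k: "is_subring k" "infinite k" and inv: "\<And>c. c \<in> k \<Longrightarrow> c \<noteq> 0 \<Longrightarrow> \<exists>c'\<in>k. c' * c = 1"
    and char0: "\<And>n. n > 0 \<Longrightarrow> (of_nat n :: 'a) \<noteq> 0"
    and X: "finite X" "\<And>R. is_subring R \<Longrightarrow> k \<subseteq> R \<Longrightarrow> X \<subseteq> R \<Longrightarrow> R = UNIV"
begin

lemma of_nat_k: "of_nat n \<in> k"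
  using k(1) by (induction n) (auto simp: is_subring_def)

lemma of_nat_dvd_1: "n > 0 \<Longrightarrow> (of_nat n :: 'a) dvd 1"
  using inv[OF of_nat_k char0] by (metis dvd_triv_right)

lemma der_over_eqI:
  assumes "der_over k d" "der_over k e" "\<And>s. s \<in> X \<Longrightarrow> c * d s = e s"
  shows "c * d y = e y"
proof -
  have D: "is_der d" "is_der e" using assms(1,2) by (auto simp: der_over_def)
  have "c * d (y * z) = e (y * z)" if "c * d y = e y" "c * d z = e z" for y z
    unfolding is_derD[OF D(1)] is_derD[OF D(2)] that[symmetric] by (simp add: algebra_simps)
  then have "is_subring {y. c * d y = e y}"
    by (auto simp: is_subring_def is_derD[OF D(1)] is_derD[OF D(2)] distrib_left right_diff_distrib)
  then have "{y. c * d y = e y} = UNIV"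
    by (rule X(2)) (use assms in \<open>auto simp: der_over_def\<close>)
  then show ?thesis by blast
qed

lemma finite_generic_derivations:
  assumes "\<And>v. v \<in> V \<Longrightarrow> der_over k v"
  obtains B where "B \<subseteq> V" "finite B"
    "\<And>v. v \<in> V \<Longrightarrow> \<exists>c w. c \<noteq> 0 \<and> w \<in> fun_module.span B \<and> (\<forall>y. c * v y = w y)"
proof -
  obtain B where B: "B \<subseteq> V" "finite B"
    and V: "\<And>v. v \<in> V \<Longrightarrow> \<exists>c w. c \<noteq> 0 \<and> w \<in> fun_module.span B \<and> (\<forall>s\<in>X. c * v s = w s)"
    using finite_generic_generators[OF X(1), of V] by blast
  have "\<exists>c w. c \<noteq> 0 \<and> w \<in> fun_module.span B \<and> (\<forall>y. c * v y = w y)" if v: "v \<in> V" for v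
  proof -
    obtain c w where "c \<noteq> 0" "w \<in> fun_module.span B" "\<forall>s\<in>X. c * v s = w s" using V v by blast
    moreover have "der_over k w" using der_over_span[OF calculation(2)] assms B(1) by blast
    ultimately show ?thesis using der_over_eqI assms[OF v] by blast
  qed
  then show ?thesis using that B by blast
qed

lemma kernel_normalized_pair:
  fixes x u \<Delta> :: 'a
  assumes D: "der_over k D0" "der_over k D1" and xu: "D0 x = \<Delta>" "D0 u = 0" "D1 x = 0" "D1 u = \<Delta>"
    and \<Delta>: "\<Delta> \<noteq> 0"
  shows "\<exists>\<alpha> \<beta>. \<forall>g. \<alpha> * D0 g + \<beta> * D1 g = 0 \<longrightarrow> D0 g = 0 \<and> D1 g = 0"
proof -
  let ?W = "nested {D0, D1}"
  have W: "der_over k e" if "e \<in> ?W m" for e m using der_over_nested[OF _ that, of k] D by blast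
  define V where "V = (\<Union>m. ?W m)"
  have "der_over k v" if "v \<in> V" for v using W that by (auto simp: V_def)
  then obtain B where B: "B \<subseteq> V" "finite B"
    and span: "\<And>e. e \<in> V \<Longrightarrow> \<exists>c w. c \<noteq> 0 \<and> w \<in> fun_module.span B \<and> (\<forall>y. c * e y = w y)"
    by (rule finite_generic_derivations) auto
  have "\<exists>l. B \<subseteq> (\<Union>m\<le>l. ?W m)"
    using B(2,1)
  proof (induction B rule: finite_induct)
    case (insert b B)
    then obtain l m where "B \<subseteq> (\<Union>m\<le>l. ?W m)" "b \<in> ?W m" by (auto simp: V_def)
    then have "insert b B \<subseteq> (\<Union>m\<le>max l m. ?W m)"
      using UN_mono[of "{..l}" "{..max l m}" ?W ?W] by auto
    then show ?case by blast
  qed simp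
  then obtain l where l: "B \<subseteq> (\<Union>m\<le>l. ?W m)" by blast
  obtain c w where c: "\<And>e. e \<in> ?W (Suc l) \<Longrightarrow> c e \<noteq> 0"
    and w: "\<And>e. e \<in> ?W (Suc l) \<Longrightarrow> w e \<in> fun_module.span B"
    and cw: "\<And>e y. e \<in> ?W (Suc l) \<Longrightarrow> c e * e y = w e y"
  proof -
    have "?W (Suc l) \<subseteq> V" unfolding V_def by (rule UN_upper) simp
    then show ?thesis using span that by (metis subsetD)
  qed
  have fW: "finite (?W (Suc l))" by (rule finite_nested) simp
  define \<tau> where "\<tau> = \<Delta> * (\<Prod>e\<in>?W (Suc l). c e)"
  have \<tau>: "\<tau> \<noteq> 0" using \<Delta> c fW by (auto simp: \<tau>_def)
  obtain as where as: "set as = X" using finite_list[OF X(1)] by blast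
  have R0: "is_subring (adjoin (adjoin k x) u)" by (intro is_subring_adjoin k)
  have "k \<subseteq> adjoin (adjoin k x) u"
    using adjoins_superset[OF k(1), of "[x, u]"] by simp
  then have gen: "adjoins (adjoin (adjoin k x) u) as = UNIV"
    using adjoins_superset[OF R0, of as] adjoins_generators[OF R0, of as]
    by (intro X(2) is_subring_adjoins R0) (auto simp: as)
  have shift: "d (z - a) = d z" if "der_over k d" "a \<in> k" for d z a
    using that by (auto simp: der_over_def is_derD)
  have tx: "transc k (x - a)" if "a \<in> k" for a
    using der_over_transc[OF k(1) D(1), of "x - a"] shift[OF D(1) that] xu \<Delta> char0 by simp
  have tu: "transc (adjoin k x) (u - a)" if "a \<in> k" for a
    using der_over_transc[OF is_subring_adjoin[OF k(1)] der_over_adjoin[OF D(2)], of x "u - a"]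
      shift[OF D(2) that] xu \<Delta> char0 by simp
  obtain a b where ab: "a \<in> k" "b \<in> k"
    and center: "\<And>y. (\<And>t. \<exists>e. \<tau> ^ e * y \<in> ideal_power UNIV (x - a) (u - b) t) \<Longrightarrow> y = 0"
    using center_exists[OF k inv tx tu gen \<tau>] by metis
  interpret adic_pair \<tau> "x - a" "u - b" \<Delta> D0 D1
    using D xu ab shift[OF D(1)] shift[OF D(2)] of_nat_dvd_1
    by unfold_locales (auto simp: der_over_def \<tau>_def)
  define s where "s = l + 2"
  have "D0 g = 0 \<and> D1 g = 0" if g: "(x - a) ^ s * D0 g + (u - b) ^ s * D1 g = 0" for g
  proof -
    have "e g \<in> S t" if e: "e \<in> ?W (Suc l)" and H: "\<And>m b. m \<le> l \<Longrightarrow> b \<in> ?W m \<Longrightarrow> b g \<in> S t" for e t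
    proof -
      have "w e g \<in> S t"
        using w[OF e]
      proof (induction rule: fun_module_span_induct)
        case (base b)
        then show ?case using l H by blast
      qed (auto simp: fun_scale_def intro: S_0 S_add S_mult)
      then have "c e * e g \<in> S t" using cw[OF e] by simp
      moreover have "c e dvd \<tau>" using e fW by (auto simp: \<tau>_def intro: dvd_mult dvd_prodI)
      ultimately show ?thesis using S_cancel_dvd by blast
    qed
    then have "D0 g \<in> S t \<and> D1 g \<in> S t" for t
      using kernel_order[of s l g t] g by (simp add: s_def)
    then show ?thesis using center unfolding S_def by blast
  qed
  then show ?thesis by blast
qed

lemma kernel_pair:
  assumes d: "der_over k d0" "der_over k d1"
  shows "\<exists>\<alpha> \<beta>. \<forall>g. \<alpha> * d0 g + \<beta> * d1 g = 0 \<longleftrightarrow> d0 g = 0 \<and> d1 g = 0"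
proof (cases "\<exists>x u. d0 x * d1 u - d0 u * d1 x \<noteq> 0")
  case True
  then obtain x u where xu: "d0 x * d1 u - d0 u * d1 x \<noteq> 0" by blast
  define \<Delta> where "\<Delta> = d0 x * d1 u - d0 u * d1 x"
  define D0 where "D0 g = d1 u * d0 g + (- d0 u) * d1 g" for g
  define D1 where "D1 g = (- d1 x) * d0 g + d0 x * d1 g" for g
  have "der_over k D0" "der_over k D1"
    unfolding D0_def D1_def by (intro der_over_lincomb d)+
  moreover have "D0 x = \<Delta>" "D0 u = 0" "D1 x = 0" "D1 u = \<Delta>"
    by (simp_all add: D0_def D1_def \<Delta>_def algebra_simps)
  ultimately obtain \<alpha> \<beta> where *: "\<And>g. \<alpha> * D0 g + \<beta> * D1 g = 0 \<Longrightarrow> D0 g = 0 \<and> D1 g = 0"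
    using kernel_normalized_pair[of D0 D1 x \<Delta> u] xu unfolding \<Delta>_def by metis
  have eq: "(\<alpha> * d1 u - \<beta> * d1 x) * d0 g + (\<beta> * d0 x - \<alpha> * d0 u) * d1 g = \<alpha> * D0 g + \<beta> * D1 g" for g
    by (simp add: D0_def D1_def algebra_simps)
  have "d0 g = 0 \<and> d1 g = 0" if "D0 g = 0" "D1 g = 0" for g
  proof -
    have "\<Delta> * d0 g = d0 x * D0 g + d0 u * D1 g" "\<Delta> * d1 g = d1 x * D0 g + d1 u * D1 g"
      by (simp_all add: D0_def D1_def \<Delta>_def algebra_simps)
    then show ?thesis using that xu by (simp add: \<Delta>_def)
  qed
  then have "\<forall>g. (\<alpha> * d1 u - \<beta> * d1 x) * d0 g + (\<beta> * d0 x - \<alpha> * d0 u) * d1 g = 0 \<longleftrightarrow> d0 g = 0 \<and> d1 g = 0"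
    using * eq by (metis add.right_neutral mult_zero_right)
  then show ?thesis by blast
next
  case False
  then have minors: "d0 x * d1 u = d0 u * d1 x" for x u by simp
  show ?thesis
  proof (cases "\<exists>x. d0 x \<noteq> 0")
    case True
    then obtain x where "d0 x \<noteq> 0" by blast
    then have "d1 g = 0" if "d0 g = 0" for g using minors[of x g] that by simp
    then show ?thesis by (intro exI[of _ 1] exI[of _ 0]) auto
  next
    case False
    then show ?thesis by (intro exI[of _ 0] exI[of _ 1]) auto
  qed
qed

lemma kernel_finite:
  assumes "finite B" "\<And>b. b \<in> B \<Longrightarrow> der_over k b"
  shows "\<exists>w\<in>fun_module.span B. \<forall>g. w g = 0 \<longleftrightarrow> (\<forall>b\<in>B. b g = 0)"
  using assms
proof (induction B rule: finite_induct)
  case empty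
  then show ?case using fun_module.span_zero by (intro bexI[of _ 0]) auto
next
  case (insert b B)
  then obtain w where w: "w \<in> fun_module.span B" "\<And>g. w g = 0 \<longleftrightarrow> (\<forall>b\<in>B. b g = 0)" by auto
  have "der_over k w" using der_over_span[OF w(1)] insert.prems by blast
  then obtain \<alpha> \<beta> where *: "\<And>g. \<alpha> * b g + \<beta> * w g = 0 \<longleftrightarrow> b g = 0 \<and> w g = 0"
    using kernel_pair[of b w] insert.prems by blast
  have "w \<in> fun_module.span (insert b B)"
    using w(1) fun_module.span_mono[of B "insert b B"] by blast
  then have "fun_scale \<alpha> b + fun_scale \<beta> w \<in> fun_module.span (insert b B)"
    by (intro fun_module.span_add fun_module.span_scale) (auto intro: fun_module.span_base)
  moreover have "(fun_scale \<alpha> b + fun_scale \<beta> w) g = 0 \<longleftrightarrow> (\<forall>b\<in>insert b B. b g = 0)" for g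
    using * w(2) by (simp add: fun_scale_def)
  ultimately show ?case by blast
qed

end

lemma fun_sum_apply: "(\<Sum>i\<in>A. f i) x = (\<Sum>i\<in>A. f i x)"
  for f :: "'i \<Rightarrow> 'b \<Rightarrow> 'a::comm_ring_1"
  by (induction A rule: infinite_finite_induct) auto

theorem theorem1p3:
  fixes scale :: "'k::field_char_0 \<Rightarrow> 'a::idom \<Rightarrow> 'a"
    and I :: "'i set"
    and d :: "'i \<Rightarrow> 'a \<Rightarrow> 'a"
  assumes "finite_type_algebra scale"
    and "\<And>i. i \<in> I \<Longrightarrow> algebra_over.derivation scale (d i)"
  shows "\<exists>J a. finite J \<and> J \<subseteq> I \<and> ker (\<lambda>x. \<Sum>i\<in>J. a i * d i x) = family_ker I d"
proof -
  interpret finite_type_algebra scale by fact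
  define k where "k = range (\<lambda>c. scale c 1)"
  have scale: "scale c y = scale c 1 * y" for c y
    using scale_mult_left[of c 1 y] by simp
  have mult: "scale c 1 * scale c' 1 = scale (c * c') 1" for c c'
    using scale[of c "scale c' 1"] by simp
  have inj: "inj (\<lambda>c. scale c 1)"
    by (auto intro!: injI simp: scale_right_imp_eq)
  have sub: "is_subring k"
  proof -
    have "scale c 1 + scale c' 1 \<in> k" "scale c 1 - scale c' 1 \<in> k" "scale c 1 * scale c' 1 \<in> k" for c c'
      unfolding mult k_def by (auto simp flip: scale_left_distrib scale_left_diff_distrib)
    moreover have "0 \<in> k" "1 \<in> k"
      unfolding k_def using rangeI[of "\<lambda>c. scale c 1" 0] rangeI[of "\<lambda>c. scale c 1" 1] by auto
    ultimately show ?thesis by (auto simp: is_subring_def k_def)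
  qed
  obtain X where X: "finite X" "subalgebra hull X = UNIV"
    using finitely_generated by blast
  interpret A: finite_type_domain k X
  proof
    show "infinite k"
      unfolding k_def using inj finite_imageD infinite_UNIV_char_0 by blast
    show "\<exists>c'\<in>k. c' * c = 1" if c: "c \<in> k" "c \<noteq> 0" for c
    proof -
      obtain a where a: "c = scale a 1" using c by (auto simp: k_def)
      then have "scale (inverse a) 1 * c = 1" using c mult[of "inverse a" a] by auto
      then show ?thesis by (auto simp: k_def)
    qed
    have "of_nat n = scale (of_nat n) 1" for n
      by (induction n) (auto simp: scale_left_distrib)
    then show "(of_nat n :: 'a) \<noteq> 0" if "n > 0" for n using that by simp
    show "R = UNIV" if R: "is_subring R" "k \<subseteq> R" "X \<subseteq> R" for R
    proof -
      have "scale c 1 * y \<in> R" if "y \<in> R" for c y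
        using that R(1,2) unfolding is_subring_def k_def by blast
      then have "subalgebra R"
        using R(1) scale unfolding subalgebra_def is_subring_def
        by (metis subspaceI)
      then have "subalgebra hull X \<subseteq> R" using R(3) by (rule hull_minimal[rotated])
      then show ?thesis using X by auto
    qed
  qed (fact sub X)+
  have der: "der_over k (d i)" if i: "i \<in> I" for i
  proof -
    have lin: "Vector_Spaces.linear scale scale (d i)" and leib: "\<And>x y. d i (x * y) = x * d i y + d i x * y"
      using assms(2)[OF i] by (auto simp: derivation_def)
    interpret lin: Vector_Spaces.linear scale scale "d i" by (fact lin)
    have D: "is_der (d i)" by (auto simp: is_der_def lin.add leib)
    have "d i (scale c 1) = 0" for c
      by (simp add: lin.scale is_derD[OF D])
    then show ?thesis using D by (auto simp: der_over_def k_def)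
  qed
  have "der_over k v" if "v \<in> d ` I" for v using der that by blast
  then obtain B where B: "B \<subseteq> d ` I" "finite B"
    and gen: "\<And>v. v \<in> d ` I \<Longrightarrow> \<exists>c w. c \<noteq> 0 \<and> w \<in> fun_module.span B \<and> (\<forall>y. c * v y = w y)"
    by (rule A.finite_generic_derivations) auto
  obtain w where w: "w \<in> fun_module.span B" "\<And>g. w g = 0 \<longleftrightarrow> (\<forall>b\<in>B. b g = 0)"
    using A.kernel_finite[OF B(2)] B(1) der by blast
  have "d i g = 0" if "i \<in> I" "w g = 0" for i g
  proof -
    obtain c v where v: "c \<noteq> 0" "v \<in> fun_module.span B" "c * d i g = v g" using gen \<open>i \<in> I\<close> by blast
    have "v g = 0"
      using v(2) by (induction rule: fun_module_span_induct) (use w(2) \<open>w g = 0\<close> in \<open>auto simp: fun_scale_def\<close>)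
    then show ?thesis using v by simp
  qed
  then have ker: "ker w = family_ker I d"
    using w(2) B(1) by (fastforce simp: ker_def family_ker_def)
  obtain J where J: "J \<subseteq> I" "inj_on d J" "B = d ` J"
    using B(1) by (meson subset_image_inj)
  have "finite J" using J B(2) finite_imageD by blast
  obtain r where "w = (\<Sum>b\<in>B. fun_scale (r b) b)"
    using w(1) fun_module.span_finite[OF B(2)] by auto
  then have "w = (\<lambda>x. \<Sum>i\<in>J. r (d i) * d i x)"
    using J by (auto simp: fun_eq_iff fun_sum_apply sum.reindex fun_scale_def)
  then show ?thesis
    using ker J(1) \<open>finite J\<close> by (intro exI[of _ J] exI[of _ "\<lambda>i. r (d i)"]) auto
qed

end
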